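(* For $q\in\mathbb{C}$ with $|q|<1$, $$\sum_{i,j\geq 0} \frac{q^{3i^2+2ij+j^2-i}}{(q;q)_{2i}(q;q)_{j}}=\frac{(q^{3},q^{11},q^{14};q^{14})_{\infty}(q^{8},q^{20};q^{28})_{\infty}}{(q;q)_{\infty}},\quad \sum_{i,j\geq 0} \frac{q^{3i^2+2ij+j^2+2i+j}}{(q;q)_{2i+1}(q;q)_{j}}=\frac{(q^{4},q^{10},q^{14};q^{14})_{\infty}(q^{6},q^{22};q^{28})_{\infty}}{(q;q)_{\infty}},$$ $$\sum_{i,j\geq 0} \frac{q^{3i^2+2ij+j^2}}{(q;q)_{2i}(q;q)_{j}}=\frac{(q^{2},q^{12},q^{14};q^{14})_{\infty}(q^{10},q^{18};q^{28})_{\infty}}{(q;q)_{\infty}},\quad \sum_{i,j\geq 0} \frac{q^{3i^2+2ij+j^2+3i+j}}{(q;q)_{2i+1}(q;q)_{j}}=\frac{(q^{5},q^{9},q^{14};q^{14})_{\infty}(q^{4},q^{24};q^{28})_{\infty}}{(q;q)_{\infty}},$$ $$\sum_{i,j\geq 0} \frac{q^{3i^2+2ij+j^2+i+j}}{(q;q)_{2i}(q;q)_{j}}=\frac{(q,q^{13},q^{14};q^{14})_{\infty}(q^{12},q^{16};q^{28})_{\infty}}{(q;q)_{\infty}},\quad \sum_{i,j\geq 0} \frac{q^{3i^2+2ij+j^2+4i+2j}}{(q;q)_{2i+1}(q;q)_{j}}=\frac{(q^{6},q^{8},q^{14};q^{14})_{\infty}(q^{2},q^{26};q^{28})_{\i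nfty}}{(q;q)_{\infty}}.$$
   Context: For $|q|<1$: $(a;q)_\infty=\prod_{k\ge0}(1-aq^k)$; for integers $n\ge0$, $(a;q)_n=\prod_{k=0}^{n-1}(1-aq^k)$; and $(a_1,\dots,a_m;q)_\infty=\prod_{k=1}^m(a_k;q)_\infty$. *)

theory Defs
  imports "HOL-Analysis.Analysis"
begin

definition qpoch :: "complex \<Rightarrow> complex \<Rightarrow> nat \<Rightarrow> complex" where
  "qpoch a q n = (\<Prod>k<n. 1 - a * q ^ k)"

text \<open>
  For \<open>norm q < 1\<close> the product converges in the sense of \<^const>\<open>convergent_prod\<close>, which tolerates
  finitely many vanishing factors; the value is then 0, as usual.
\<close>

definition qpoch_inf :: "complex \<Rightarrow> complex \<Rightarrow> complex" where
  "qpoch_inf a q = (\<Prod>k. 1 - a * q ^ k)"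

definition qpochs_inf :: "complex list \<Rightarrow> complex \<Rightarrow> complex" where
  "qpochs_inf as q = (\<Prod>a\<leftarrow>as. qpoch_inf a q)"

text \<open>
  Double sums over \<open>i, j \<ge> 0\<close> are stated with \<^const>\<open>HAS_SUM\<close> over all pairs of naturals, which asserts
  unconditional convergence along with the value (\<^const>\<open>infsum\<close> would be 0 on divergence).  In an
  exponent \<open>3*i^2 + 2*i*j + j^2 - i\<close> the subtraction on \<^typ>\<open>nat\<close> never truncates, as \<open>i \<le> 3*i^2\<close>.
\<close>

end

theory Submission
  imports Defs
begin

text \<open>
  Write \<open>q = t\<^sup>2\<close>, \<open>m = 2 i\<close> or \<open>2 i + 1\<close>, and \<open>M = m + 2 j\<close>. Up to a fixed power of \<open>t\<close> the six exponents are
  \<open>M\<^sup>2/4 + m(m - 1)/2\<close>, \<open>M\<^sup>2/4 + m\<^sup>2/2\<close> and \<open>M\<^sup>2/4 + M/2 + m\<^sup>2/2\<close>, each for both parities of \<open>M\<close>.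
  For fixed \<open>M\<close> the inner sums \<open>A\<^sub>M\<close> (from \<open>m(m - 1)/2\<close>) and \<open>B\<^sub>M\<close> (from \<open>m\<^sup>2/2\<close>) satisfy
  \<open>A\<^sub>M = A\<^sub>M\<^sub>-\<^sub>1 + t\<^sup>M B\<^sub>M\<close> and \<open>B\<^sub>M = B\<^sub>M\<^sub>-\<^sub>2 + t\<^sup>M A\<^sub>M\<close>. The sums
  \<open>\<Sum> c(u - v) / ((q)\<^sub>u (q)\<^sub>v)\<close> over \<open>u + v = M\<close>, with \<open>c r = 0\<close> or \<open>c r = \<plusminus> t ^ (2 r (r - 1)/3)\<close>, respectively \<open>\<plusminus> t ^ (r (2 r + 1)/3)\<close>, satisfy
  the same recurrences, hence these are Bailey pairs. Since \<open>(u + v)\<^sup>2/4 = u v + (u - v)\<^sup>2/4\<close>, summing over \<open>M\<close>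
  and applying Cauchy's Durfee-rectangle identity leaves a theta series over \<open>(q; q)\<^sub>\<infinity>\<close>, which the
  quintuple product identity with base \<open>q\<^sup>1\<^sup>4\<close> evaluates. The third family reduces to the second
  because \<open>B\<^sub>M\<close> is also a sum over \<open>u + v = M + 1\<close>, with shifted weights \<open>c(r - 1)\<close>.
\<close>

subsection \<open>Pochhammer symbols and the Durfee-rectangle identity\<close>

lemma qpoch_0 [simp]: "qpoch a q 0 = 1"
  by (simp add: qpoch_def)

lemma qpoch_Suc: "qpoch a q (Suc n) = qpoch a q n * (1 - a * q ^ n)"
  by (simp add: qpoch_def)

lemma one_minus_power_nonzero:
  fixes q :: complex
  assumes "norm q < 1" "n > 0"
  shows "1 - q ^ n \<noteq> 0"
proof
  assume "1 - q ^ n = 0"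
  then have "norm (q ^ n) = 1" by simp
  moreover have "norm q ^ n < 1"
    using assms by (simp add: power_less_one_iff)
  ultimately show False by (simp add: norm_power)
qed

lemma qpoch_self_nonzero:
  assumes "norm q < 1"
  shows "qpoch q q n \<noteq> 0"
  using one_minus_power_nonzero[OF assms, of "Suc _"] by (simp add: qpoch_def)

lemma convergent_prod_qpoch:
  fixes a q :: complex
  assumes "norm q < 1"
  shows "convergent_prod (\<lambda>k. 1 - a * q ^ k)"
proof -
  have "summable (\<lambda>k. norm (a * q ^ k))"
    unfolding norm_mult norm_power using assms by (intro summable_mult summable_geometric) simp
  then have "abs_convergent_prod (\<lambda>k. 1 - a * q ^ k)"
    by (subst abs_convergent_prod_conv_summable) simp
  then show ?thesis
    by (rule abs_convergent_prod_imp_convergent_prod)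
qed

lemma qpoch_LIMSEQ:
  assumes "norm q < 1"
  shows "qpoch a q \<longlonglongrightarrow> qpoch_inf a q"
proof -
  have "(\<lambda>n. \<Prod>k\<le>n. 1 - a * q ^ k) \<longlonglongrightarrow> qpoch_inf a q"
    unfolding qpoch_inf_def by (rule convergent_prod_LIMSEQ[OF convergent_prod_qpoch[OF assms]])
  then have "(\<lambda>n. qpoch a q (Suc n)) \<longlonglongrightarrow> qpoch_inf a q"
    by (simp add: qpoch_def lessThan_Suc_atMost)
  then show ?thesis by (rule LIMSEQ_imp_Suc)
qed

lemma qpoch_inf_self_nonzero:
  assumes "norm q < 1"
  shows "qpoch_inf q q \<noteq> 0"
  unfolding qpoch_inf_def
proof (rule prodinf_nonzero[OF convergent_prod_qpoch[OF assms]])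
  show "1 - q * q ^ k \<noteq> 0" for k
    using one_minus_power_nonzero[OF assms, of "Suc k"] by simp
qed

text \<open>The reciprocals converge, hence are bounded. The uniform bound replaces the denominators
  in the later majorants.\<close>

lemma qpoch_self_inverse_bounded:
  assumes "norm q < 1"
  obtains C where "C > 0" "\<And>n. norm (1 / qpoch q q n) \<le> C"
proof -
  have "(\<lambda>n. 1 / qpoch q q n) \<longlonglongrightarrow> 1 / qpoch_inf q q"
    by (intro tendsto_intros qpoch_LIMSEQ qpoch_inf_self_nonzero assms)
  then have "Bseq (\<lambda>n. 1 / qpoch q q n)"
    by (intro convergent_imp_Bseq convergentI)
  then show ?thesis
    using that by (elim BseqE) auto
qed

lemma norm_power_le:
  fixes q :: complex
  assumes "norm q < 1" "m \<le> n"
  shows "norm (q ^ n) \<le> norm q ^ m"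
  using assms by (simp add: norm_power power_decreasing)

text \<open>The Durfee-rectangle sums \<open>L s\<close> below do not depend on \<open>s\<close>, because
  \<open>L s - L (s + 1) = - q\<^sup>s\<^sup>+\<^sup>1 (L (s + 1) - L (s + 2))\<close> can be iterated to infinity.\<close>

lemma durfee_rectangle_sum:
  fixes q :: complex
  assumes q: "norm q < 1"
  shows "((\<lambda>j. q ^ (j * (j + s)) / (qpoch q q j * qpoch q q (j + s))) has_sum 1 / qpoch_inf q q) UNIV"
proof -
  obtain C where C: "C > 0" "\<And>n. norm (1 / qpoch q q n) \<le> C"
    using qpoch_self_inverse_bounded[OF q] by blast
  define f where "f s j = q ^ (j * (j + s)) / (qpoch q q j * qpoch q q (j + s))" for s j
  define L where "L s = suminf (f s)" for s
  have nz: "qpoch q q n \<noteq> 0" for n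
    using qpoch_self_nonzero[OF q] .
  have bound: "norm (f s j) \<le> C\<^sup>2 * norm q ^ k" if "k \<le> j * (j + s)" for s j k
  proof -
    have "norm (f s j) = norm (q ^ (j * (j + s))) * (norm (1 / qpoch q q j) * norm (1 / qpoch q q (j + s)))"
      by (simp add: f_def norm_mult norm_divide)
    also have "\<dots> \<le> norm q ^ k * (C * C)"
      using C by (intro mult_mono norm_power_le q that mult_nonneg_nonneg) auto
    finally show ?thesis by (simp add: power2_eq_square mult.commute)
  qed
  have geo: "summable (\<lambda>j. C\<^sup>2 * norm q ^ j)" "(\<Sum>j. C\<^sup>2 * norm q ^ j) = C\<^sup>2 / (1 - norm q)"
    using q by (simp_all add: summable_mult suminf_mult suminf_geometric)
  have bound': "norm (f s j) \<le> C\<^sup>2 * norm q ^ j" for s j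
    by (rule bound) (cases j; simp)
  have summ_norm: "summable (\<lambda>j. norm (f s j))" for s
    by (rule summable_comparison_test[OF _ geo(1)]) (use bound' in auto)
  have summ: "summable (f s)" for s
    by (rule summable_norm_cancel[OF summ_norm])
  define B where "B = C\<^sup>2 / (1 - norm q)"
  have LB: "norm (L s) \<le> B" for s
    unfolding L_def B_def geo(2)[symmetric]
    by (rule order.trans[OF summable_norm[OF summ_norm]], rule suminf_le[OF bound' summ_norm geo(1)])
  have step: "L s - L (Suc s) = - (q ^ Suc s) * (L (Suc s) - L (Suc (Suc s)))" for s
  proof -
    \<comment> \<open>Over the denominator of \<open>f (Suc s) j\<close>, the difference
      \<open>f s j - f (Suc s) j\<close> carries the factor \<open>1 - q^j - q^(j+s+1)\<close>. The
      part \<open>1 - q^j\<close> cancels a factor of \<open>qpoch q q j\<close> and leads to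
      \<open>f (Suc (Suc s))\<close>; the rest is a multiple of \<open>f (Suc s) j\<close>.\<close>
    define g where "g j = q ^ (j * (j + s)) * (1 - q ^ j) / (qpoch q q j * qpoch q q (j + Suc s))" for j
    have g0: "g 0 = 0" by (simp add: g_def)
    have gS: "g (Suc j) = q ^ Suc s * f (Suc (Suc s)) j" for j
    proof -
      have "1 - q ^ Suc j \<noteq> 0" using one_minus_power_nonzero[OF q, of "Suc j"] by simp
      moreover have "qpoch q q (Suc j) = qpoch q q j * (1 - q ^ Suc j)"
        by (simp add: qpoch_Suc)
      moreover have "Suc j * (Suc j + s) = Suc s + j * (j + Suc (Suc s))"
        by (simp add: algebra_simps)
      moreover have "Suc j + Suc s = j + Suc (Suc s)" by simp
      ultimately show ?thesis
        unfolding g_def f_def by (simp only: power_add) (simp del: power_Suc add_Suc_right)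
    qed
    have "(\<lambda>j. g (Suc j)) sums (q ^ Suc s * L (Suc (Suc s)))"
      unfolding gS L_def by (intro sums_mult summable_sums summ)
    then have gs: "g sums (q ^ Suc s * L (Suc (Suc s)))"
      using g0 sums_Suc_iff[of g] by simp
    have fg: "f s j - f (Suc s) j = g j - q ^ Suc s * f (Suc s) j" for j
    proof -
      have nn: "1 - q ^ (j + Suc s) \<noteq> 0" using one_minus_power_nonzero[OF q, of "j + Suc s"] by simp
      have "qpoch q q (j + Suc s) = qpoch q q (j + s) * (1 - q ^ (j + Suc s))"
        by (simp add: qpoch_Suc)
      then have "f s j = q ^ (j * (j + s)) * (1 - q ^ (j + Suc s)) / (qpoch q q j * qpoch q q (j + Suc s))"
        using nn by (simp add: f_def del: power_Suc add_Suc_right)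
      also have "\<dots> - f (Suc s) j = (q ^ (j * (j + s)) * (1 - q ^ (j + Suc s)) - q ^ (j * (j + Suc s)))
          / (qpoch q q j * qpoch q q (j + Suc s))"
        by (simp add: f_def diff_divide_distrib)
      also have "q ^ (j * (j + Suc s)) = q ^ (j * (j + s)) * q ^ j"
        by (simp add: algebra_simps flip: power_add)
      also have "q ^ (j * (j + s)) * (1 - q ^ (j + Suc s)) - q ^ (j * (j + s)) * q ^ j
          = q ^ (j * (j + s)) * (1 - q ^ j) - q ^ Suc s * (q ^ (j * (j + s)) * q ^ j)"
        by (simp add: power_add algebra_simps)
      also have "q ^ (j * (j + s)) * q ^ j = q ^ (j * (j + Suc s))"
        by (simp add: algebra_simps flip: power_add)
      finally show ?thesis
        by (simp add: g_def f_def diff_divide_distrib)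
    qed
    have "(\<lambda>j. f s j - f (Suc s) j) sums (L s - L (Suc s))"
      unfolding L_def by (intro sums_diff summable_sums summ)
    moreover have "(\<lambda>j. g j - q ^ Suc s * f (Suc s) j) sums (q ^ Suc s * L (Suc (Suc s)) - q ^ Suc s * L (Suc s))"
      by (intro sums_diff gs sums_mult) (simp add: L_def summable_sums summ)
    ultimately show ?thesis
      unfolding fg by (metis (no_types, lifting) mult_minus_left minus_diff_eq right_diff_distrib sums_unique2)
  qed
  have iter: "norm (L s - L (Suc s)) \<le> norm q ^ n * (2 * B)" for s n
  proof (induction n arbitrary: s)
    case 0
    show ?case using norm_triangle_ineq4[of "L s" "L (Suc s)"] LB[of s] LB[of "Suc s"] by simp
  next
    case (Suc n)
    have "norm (L s - L (Suc s)) = norm (q ^ Suc s) * norm (L (Suc s) - L (Suc (Suc s)))"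
      by (subst step) (simp add: norm_mult)
    also have "\<dots> \<le> norm q ^ 1 * (norm q ^ n * (2 * B))"
      by (intro mult_mono norm_power_le q Suc.IH) auto
    finally show ?case by simp
  qed
  have "L s = L (Suc s)" for s
  proof -
    have "(\<lambda>n. norm q ^ n * (2 * B)) \<longlonglongrightarrow> 0 * (2 * B)"
      using q by (intro tendsto_intros LIMSEQ_realpow_zero) auto
    then have "norm (L s - L (Suc s)) \<le> 0 * (2 * B)"
      by (rule tendsto_lowerbound) (use iter in auto)
    then show ?thesis by simp
  qed
  then have "L s = L 0" for s
    by (induction s) auto
  then obtain K where const: "\<And>s. L s = K"
    by blast
  \<comment> \<open>Only the term \<open>j = 0\<close> survives for large \<open>s\<close>, which
    identifies the constant \<open>K\<close>.\<close>
  have "(\<lambda>s. L s - 1 / qpoch q q s) \<longlonglongrightarrow> 0"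
  proof (rule Lim_null_comparison)
    show "\<forall>\<^sub>F s in sequentially. norm (L s - 1 / qpoch q q s) \<le> norm q ^ s * B"
    proof (rule always_eventually, rule allI)
      fix s
      have eq: "L s - 1 / qpoch q q s = (\<Sum>j. f s (Suc j))"
        unfolding L_def by (subst suminf_split_head[OF summ]) (simp add: f_def)
      have le: "norm (f s (Suc j)) \<le> norm q ^ s * (C\<^sup>2 * norm q ^ j)" for j
        using bound[of "s + j" "Suc j" s] by (simp add: power_add algebra_simps)
      have "norm (L s - 1 / qpoch q q s) \<le> (\<Sum>j. norm (f s (Suc j)))"
        unfolding eq by (rule summable_norm) (simp add: summable_Suc_iff[of "\<lambda>j. norm (f s j)"] summ_norm)
      also have "\<dots> \<le> (\<Sum>j. norm q ^ s * (C\<^sup>2 * norm q ^ j))"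
        by (intro suminf_le le summable_mult geo(1))
           (simp add: summable_Suc_iff[of "\<lambda>j. norm (f s j)"] summ_norm)
      also have "\<dots> = norm q ^ s * B"
        unfolding B_def geo(2)[symmetric] by (rule suminf_mult[OF geo(1)])
      finally show "norm (L s - 1 / qpoch q q s) \<le> norm q ^ s * B" .
    qed
    have "(\<lambda>n. norm q ^ n * B) \<longlonglongrightarrow> 0 * B"
      using q by (intro tendsto_intros LIMSEQ_realpow_zero) auto
    then show "(\<lambda>s. norm q ^ s * B) \<longlonglongrightarrow> 0" by simp
  qed
  moreover have "(\<lambda>s. L s - 1 / qpoch q q s) \<longlonglongrightarrow> K - 1 / qpoch_inf q q"
    unfolding const by (intro tendsto_intros qpoch_LIMSEQ qpoch_inf_self_nonzero q)
  ultimately have "K = 1 / qpoch_inf q q"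
    using LIMSEQ_unique by fastforce
  then have "f s sums (1 / qpoch_inf q q)"
    using summable_sums[OF summ, of s] const[of s] by (simp add: L_def)
  then show ?thesis
    using norm_summable_imp_has_sum[OF summ_norm, of s] unfolding f_def by simp
qed

lemma has_sum_product_UNIV:
  fixes f :: "'a \<Rightarrow> complex" and g :: "'b \<Rightarrow> complex"
  assumes "(f has_sum S) UNIV" "(g has_sum T) UNIV"
  shows "((\<lambda>(x, y). f x * g y) has_sum S * T) UNIV"
proof -
  have "(\<lambda>x. norm (f x)) summable_on UNIV" "(\<lambda>y. norm (g y)) summable_on UNIV"
    using assms by (auto simp: has_sum_imp_summable simp flip: summable_on_iff_abs_summable_on_complex)
  then have "(\<lambda>xy. norm ((\<lambda>(x, y). f x * g y) xy)) summable_on UNIV \<times> UNIV"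
    by (subst Infinite_Sum.abs_summable_on_Sigma_iff)
       (auto simp: norm_mult infsum_cmult_right' abs_mult infsum_nonneg
             intro!: summable_on_cmult_right summable_on_cmult_left)
  then have "(\<lambda>(x, y). f x * g y) summable_on UNIV \<times> UNIV"
    by (rule abs_summable_summable)
  then have "((\<lambda>(x, y). f x * g y) has_sum S * T) (UNIV \<times> UNIV)"
    by (intro has_sum_SigmaI[where g = "\<lambda>x. f x * T"])
       (auto intro!: has_sum_cmult_right has_sum_cmult_left assms)
  then show ?thesis by simp
qed

text \<open>Use the coordinates \<open>r = u - v\<close> and \<open>j = min u v\<close>, so that
  \<open>u * v = j * (j + |r|)\<close>. For fixed \<open>r\<close> the sum over \<open>j\<close> is
  a Durfee-rectangle sum, whose value does not depend on \<open>r\<close> and factors out.\<close>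

lemma durfee_rearrangement:
  fixes q :: complex and \<gamma> :: "int \<Rightarrow> complex"
  assumes q: "norm q < 1" and \<gamma>: "(\<gamma> has_sum S) UNIV"
  shows "((\<lambda>(u, v). q ^ (u * v) * \<gamma> (int u - int v) / (qpoch q q u * qpoch q q v))
           has_sum S / qpoch_inf q q) UNIV"
proof -
  obtain C where C: "C > 0" "\<And>n. norm (1 / qpoch q q n) \<le> C"
    using qpoch_self_inverse_bounded[OF q] by blast
  define F where "F = (\<lambda>(r, j). \<gamma> r * (q ^ (j * (j + nat \<bar>r\<bar>)) / (qpoch q q j * qpoch q q (j + nat \<bar>r\<bar>))))"
  have "(\<lambda>r. norm (\<gamma> r)) summable_on UNIV"
    using \<gamma> by (auto simp: has_sum_imp_summable simp flip: summable_on_iff_abs_summable_on_complex)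
  moreover have "(\<lambda>j. C\<^sup>2 * norm q ^ j) summable_on UNIV"
    using q by (intro summable_nonneg_imp_summable_on summable_mult summable_geometric) auto
  ultimately have "(\<lambda>(r, j). norm (\<gamma> r) * (C\<^sup>2 * norm q ^ j)) summable_on UNIV \<times> UNIV"
    by (intro summable_on_SigmaI[where g = "\<lambda>r. norm (\<gamma> r) * infsum (\<lambda>j. C\<^sup>2 * norm q ^ j) UNIV"])
       (auto intro!: has_sum_cmult_right summable_on_cmult_left mult_nonneg_nonneg)
  then have "(\<lambda>x. norm (F x)) summable_on UNIV \<times> UNIV"
  proof (rule Infinite_Sum.abs_summable_on_comparison_test', safe)
    fix r :: int and j :: nat
    have "norm (F (r, j)) = norm (\<gamma> r) * (norm (q ^ (j * (j + nat \<bar>r\<bar>))) *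
            (norm (1 / qpoch q q j) * norm (1 / qpoch q q (j + nat \<bar>r\<bar>))))"
      by (simp add: F_def norm_mult norm_divide)
    also have "\<dots> \<le> norm (\<gamma> r) * (norm q ^ j * (C * C))"
      using C by (intro mult_mono order.refl norm_power_le q mult_nonneg_nonneg) auto
    finally show "norm (F (r, j)) \<le> norm (\<gamma> r) * (C\<^sup>2 * norm q ^ j)"
      by (simp add: power2_eq_square mult_ac)
  qed
  then have "F summable_on UNIV \<times> UNIV"
    by (rule abs_summable_summable)
  then have "(F has_sum S * (1 / qpoch_inf q q)) (UNIV \<times> UNIV)"
    unfolding F_def
    by (intro has_sum_SigmaI[where g = "\<lambda>r. \<gamma> r * (1 / qpoch_inf q q)"])
       (auto intro!: has_sum_cmult_right has_sum_cmult_left has_sum_divide_const \<gamma> durfee_rectangle_sum q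
             simp del: times_divide_eq_right)
  also have "?this \<longleftrightarrow> ((\<lambda>(u, v). q ^ (u * v) * \<gamma> (int u - int v) / (qpoch q q u * qpoch q q v))
           has_sum S / qpoch_inf q q) UNIV"
  proof (rule has_sum_reindex_bij_witness)
    fix x :: "int \<times> nat"
    obtain r j where x: "x = (r, j)" by (cases x)
    show "(\<lambda>(u, v). (int u - int v, min u v)) ((\<lambda>(r, j). (j + nat r, j + nat (- r))) x) = x"
      by (auto simp: x)
    show "(case (\<lambda>(r, j). (j + nat r, j + nat (- r))) x of
         (u, v) \<Rightarrow> q ^ (u * v) * \<gamma> (int u - int v) / (qpoch q q u * qpoch q q v)) = F x"
      by (cases "r \<ge> 0") (auto simp: x F_def mult_ac)
  next
    fix y :: "nat \<times> nat"
    show "(\<lambda>(r, j). (j + nat r, j + nat (- r))) ((\<lambda>(u, v). (int u - int v, min u v)) y) = y"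
      by (auto split: prod.splits)
  qed auto
  finally show ?thesis .
qed

section \<open>Euler's expansion of the infinite product\<close>

lemma euler_coefficients_summable:
  fixes q z :: complex
  assumes q: "norm q < 1"
  shows "summable (\<lambda>n. norm (q ^ (n choose 2) / qpoch q q n * z ^ n))"
proof -
  obtain C where C: "C > 0" "\<And>n. norm (1 / qpoch q q n) \<le> C"
    using qpoch_self_inverse_bounded[OF q] by blast
  \<comment> \<open>Consecutive terms \<open>q^(n choose 2) * z^n\<close> have ratio
    \<open>z * q^n\<close>, eventually at most 1/2 in norm.\<close>
  have "(\<lambda>n. norm z * norm q ^ n) \<longlonglongrightarrow> norm z * 0"
    using q by (intro tendsto_intros LIMSEQ_realpow_zero) auto
  then have "\<forall>\<^sub>F n in sequentially. norm z * norm q ^ n < 1/2"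
    by (intro order_tendstoD(2)) auto
  then obtain N where N: "\<And>n. n \<ge> N \<Longrightarrow> norm z * norm q ^ n \<le> 1/2"
    by (force simp: eventually_sequentially)
  have "summable (\<lambda>n. norm q ^ (n choose 2) * norm z ^ n)"
  proof (rule summable_ratio_test[where c = "1/2" and N = N])
    fix n assume "n \<ge> N"
    then have "(norm q ^ (n choose 2) * norm z ^ n) * (norm z * norm q ^ n)
        \<le> (norm q ^ (n choose 2) * norm z ^ n) * (1/2)"
      by (intro mult_left_mono N) auto
    then show "norm (norm q ^ (Suc n choose 2) * norm z ^ Suc n) \<le> 1/2 * norm (norm q ^ (n choose 2) * norm z ^ n)"
      by (simp add: numeral_2_eq_2 power_add norm_mult mult_ac)
  qed auto
  then have "summable (\<lambda>n. C * (norm q ^ (n choose 2) * norm z ^ n))"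
    by (rule summable_mult)
  then show ?thesis
  proof (rule summable_comparison_test[rotated], intro exI allI impI)
    fix n
    have "norm (1 / qpoch q q n) * (norm q ^ (n choose 2) * norm z ^ n) \<le> C * (norm q ^ (n choose 2) * norm z ^ n)"
      by (intro mult_right_mono C) auto
    then show "norm (norm (q ^ (n choose 2) / qpoch q q n * z ^ n)) \<le> C * (norm q ^ (n choose 2) * norm z ^ n)"
      by (simp add: norm_mult norm_divide norm_power)
  qed
qed

text \<open>The power series \<open>g\<close> satisfies \<open>g w = (1 + w) * g (q * w)\<close>.
  Iterating from \<open>w = - z\<close> splits off the factors of the product, and the remaining
  \<open>g (q^n * (- z))\<close> tends to \<open>g 0 = 1\<close> by continuity.\<close>

lemma euler_product_expansion:
  fixes q z :: complex
  assumes q: "norm q < 1"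
  shows "((\<lambda>n. (- z) ^ n * q ^ (n choose 2) / qpoch q q n) has_sum qpoch_inf z q) UNIV"
proof -
  define c where "c n = q ^ (n choose 2) / qpoch q q n" for n
  define g where "g w = (\<Sum>n. c n * w ^ n)" for w
  have nz: "qpoch q q n \<noteq> 0" for n
    using qpoch_self_nonzero[OF q] .
  have summ_norm: "summable (\<lambda>n. norm (c n * w ^ n))" for w
    unfolding c_def by (rule euler_coefficients_summable[OF q])
  have summ: "summable (\<lambda>n. c n * w ^ n)" for w
    by (rule summable_norm_cancel[OF summ_norm])
  have step: "g w = (1 + w) * g (q * w)" for w
  proof -
    define h where "h n = c n * w ^ n - c n * (q * w) ^ n" for n
    have hS: "h (Suc n) = w * (c n * (q * w) ^ n)" for n
    proof -
      have "1 - q * q ^ n \<noteq> 0" using one_minus_power_nonzero[OF q, of "Suc n"] by simp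
      moreover have "h (Suc n) = c (Suc n) * (1 - q * q ^ n) * w ^ Suc n"
        by (simp add: h_def power_mult_distrib algebra_simps)
      moreover have "c (Suc n) * (1 - q * q ^ n) = q ^ n * c n"
        using calculation(1) nz by (simp add: c_def qpoch_Suc numeral_2_eq_2 power_add field_simps)
      ultimately show ?thesis
        by (simp add: power_mult_distrib mult_ac)
    qed
    have "(\<lambda>n. h (Suc n)) sums (w * g (q * w))"
      unfolding hS g_def by (intro sums_mult summable_sums summ)
    moreover have "h 0 = 0" by (simp add: h_def)
    ultimately have "h sums (w * g (q * w))"
      using sums_Suc_iff[of h] by simp
    moreover have "h sums (g w - g (q * w))"
      unfolding h_def g_def by (intro sums_diff summable_sums summ)
    ultimately have "w * g (q * w) = g w - g (q * w)"
      by (rule sums_unique2)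
    then show ?thesis by (simp add: algebra_simps)
  qed
  have iter: "g (- z) = qpoch z q n * g (q ^ n * (- z))" for n
  proof (induction n)
    case (Suc n)
    also have "g (q ^ n * (- z)) = (1 - z * q ^ n) * g (q ^ Suc n * (- z))"
      by (subst step) (simp add: mult_ac)
    finally show ?case by (simp add: qpoch_Suc mult_ac)
  qed simp
  have cont: "isCont g 0"
    unfolding g_def by (rule isCont_powser_converges_everywhere[OF summ])
  have "(\<lambda>n. q ^ n * (- z)) \<longlonglongrightarrow> 0 * (- z)"
    using q by (intro tendsto_intros LIMSEQ_power_zero) auto
  then have "(\<lambda>n. g (q ^ n * (- z))) \<longlonglongrightarrow> g 0"
    using cont by (intro isCont_tendsto_compose[OF cont]) auto
  moreover have "g 0 = 1"
    unfolding g_def by (subst powser_zero) (simp add: c_def numeral_2_eq_2)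
  ultimately have "(\<lambda>n. qpoch z q n * g (q ^ n * (- z))) \<longlonglongrightarrow> qpoch_inf z q * 1"
    by (intro tendsto_mult qpoch_LIMSEQ q) auto
  then have "(\<lambda>n::nat. g (- z)) \<longlonglongrightarrow> qpoch_inf z q"
    using iter by simp
  then have "g (- z) = qpoch_inf z q"
    by (simp add: LIMSEQ_const_iff)
  then have "(\<lambda>n. c n * (- z) ^ n) sums qpoch_inf z q"
    using summable_sums[OF summ, of "- z"] by (simp add: g_def)
  then have "((\<lambda>n. c n * (- z) ^ n) has_sum qpoch_inf z q) UNIV"
    by (rule norm_summable_imp_has_sum[OF summ_norm])
  then show ?thesis by (simp add: c_def mult_ac)
qed

subsection \<open>The Jacobi triple product\<close>

lemma has_sum_int_split:
  fixes f :: "int \<Rightarrow> complex"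
  assumes "(\<lambda>n. f (int n)) summable_on UNIV" "(\<lambda>n. f (- int n)) summable_on UNIV"
  shows "f summable_on UNIV"
proof -
  have "f summable_on range int"
    using assms(1) by (subst summable_on_reindex) (auto simp: o_def)
  moreover have "f summable_on range (\<lambda>n. - int n)"
    using assms(2) by (subst summable_on_reindex) (auto simp: o_def inj_def)
  moreover have "range int \<union> range (\<lambda>n. - int n) = UNIV"
    by (auto simp: image_iff) (metis int_cases2)
  ultimately show ?thesis
    by (metis summable_on_union)
qed

lemma power_choose_two:
  fixes q :: complex
  shows "q powi (int n * (int n - 1) div 2) = q ^ (n choose 2)"
proof -
  have "int n * (int n - 1) div 2 = int (n choose 2)"
    by (cases n) (auto simp: choose_two zdiv_int algebra_simps)
  then show ?thesis by simp
qed

text \<open>Both halves of the bilateral series have the form \<open>w^n * q^(n choose 2)\<close>,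
  with \<open>w = - z\<close> for \<open>n \<ge> 0\<close> and \<open>w = - q / z\<close> for
  \<open>n \<le> 0\<close>.\<close>

lemma theta_summable:
  fixes q z :: complex
  assumes q: "norm q < 1" "q \<noteq> 0" and z: "z \<noteq> 0"
  shows "(\<lambda>n::int. (- z) powi n * q powi (n * (n - 1) div 2)) summable_on UNIV"
proof -
  have gen: "(\<lambda>n. w ^ n * q ^ (n choose 2)) summable_on UNIV" for w
  proof -
    \<comment> \<open>Bounding \<open>qpoch q q n\<close> itself allows the denominator to be
      dropped from Euler's summable series.\<close>
    obtain K where K: "\<And>n. norm (qpoch q q n) \<le> K"
      using convergent_imp_Bseq[OF convergentI[OF qpoch_LIMSEQ[OF q(1), of q]]] by (elim BseqE) auto
    have "summable (\<lambda>n. K * norm (q ^ (n choose 2) / qpoch q q n * w ^ n))"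
      by (intro summable_mult euler_coefficients_summable q)
    then have "summable (\<lambda>n. norm (w ^ n * q ^ (n choose 2)))"
    proof (rule summable_comparison_test[rotated], intro exI allI impI)
      fix n
      have "norm (w ^ n * q ^ (n choose 2)) = norm (qpoch q q n) * norm (q ^ (n choose 2) / qpoch q q n * w ^ n)"
        using qpoch_self_nonzero[OF q(1)] by (simp add: norm_mult norm_divide)
      also have "\<dots> \<le> K * norm (q ^ (n choose 2) / qpoch q q n * w ^ n)"
        by (intro mult_right_mono K) auto
      finally show "norm (norm (w ^ n * q ^ (n choose 2))) \<le> \<dots>" by simp
    qed
    then show ?thesis by (rule norm_summable_imp_summable_on)
  qed
  show ?thesis
  proof (rule has_sum_int_split)
    show "(\<lambda>n. (- z) powi int n * q powi (int n * (int n - 1) div 2)) summable_on UNIV"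
      using gen[of "- z"] by (simp only: power_choose_two power_int_of_nat)
    have "(- z) powi (- int n) * q powi (- int n * (- int n - 1) div 2) = (- q / z) ^ n * q ^ (n choose 2)" for n
    proof -
      have "- int n * (- int n - 1) = 2 * int n + int n * (int n - 1)"
        by (simp add: algebra_simps)
      then have "- int n * (- int n - 1) div 2 = int n + int n * (int n - 1) div 2"
        by simp
      then have "q powi (- int n * (- int n - 1) div 2) = q ^ n * q ^ (n choose 2)"
        using q by (simp add: power_int_add power_choose_two)
      moreover have "(- z) powi (- int n) = 1 / (- z) ^ n"
        by (simp only: power_int_minus power_int_of_nat inverse_eq_divide)
      moreover have "(- q / z) ^ n = q ^ n / (- z) ^ n"
        by (metis minus_divide_left minus_divide_right power_divide)
      ultimately show ?thesis
        by (simp only: times_divide_eq_left mult_1 mult.assoc)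
    qed
    then show "(\<lambda>n. (- z) powi (- int n) * q powi (- int n * (- int n - 1) div 2)) summable_on UNIV"
      using gen[of "- q / z"] by simp
  qed
qed

text \<open>In the product of the Euler expansions of \<open>(z; q)\<^sub>\<infinity>\<close> and \<open>(q/z; q)\<^sub>\<infinity>\<close> the exponents satisfy
  \<open>u(u - 1)/2 + v(v + 1)/2 = u v + n(n - 1)/2\<close> with \<open>n = u - v\<close>, so the Durfee rearrangement applies.\<close>

theorem jacobi_triple_product:
  fixes q z :: complex
  assumes q: "norm q < 1" "q \<noteq> 0" and z: "z \<noteq> 0"
  shows "((\<lambda>n::int. (- z) powi n * q powi (n * (n - 1) div 2)) has_sum
           qpoch_inf z q * qpoch_inf (q / z) q * qpoch_inf q q) UNIV"
proof -
  define \<gamma> where "\<gamma> n = (- z) powi n * q powi (n * (n - 1) div 2)" for n :: int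
  \<comment> \<open>The value is still unknown here; evaluating the same double sum as a product and
    by the Durfee rearrangement determines it.\<close>
  have \<gamma>: "(\<gamma> has_sum infsum \<gamma> UNIV) UNIV"
    unfolding \<gamma>_def by (rule has_sum_infsum[OF theta_summable[OF q z]])
  have "((\<lambda>(u, v). ((- z) ^ u * q ^ (u choose 2) / qpoch q q u) *
           ((- (q / z)) ^ v * q ^ (v choose 2) / qpoch q q v))
         has_sum qpoch_inf z q * qpoch_inf (q / z) q) UNIV"
    by (intro has_sum_product_UNIV euler_product_expansion q)
  also have "(\<lambda>(u, v). ((- z) ^ u * q ^ (u choose 2) / qpoch q q u) *
           ((- (q / z)) ^ v * q ^ (v choose 2) / qpoch q q v)) =
         (\<lambda>(u, v). q ^ (u * v) * \<gamma> (int u - int v) / (qpoch q q u * qpoch q q v))"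
  proof -
    have "(- z) ^ u * q ^ (u choose 2) * ((- (q / z)) ^ v * q ^ (v choose 2)) = q ^ (u * v) * \<gamma> (int u - int v)"
      for u v
    proof -
      have e: "(int u - int v) * ((int u - int v) - 1) = 2 * (int v - int u * int v) + int u * (int u - 1) + int v * (int v - 1)"
        by (simp add: algebra_simps)
      have ev: "even (int n * (int n - 1))" for n by simp
      have "(int u - int v) * ((int u - int v) - 1) div 2
          = int v - int (u * v) + int u * (int u - 1) div 2 + int v * (int v - 1) div 2"
        unfolding e using ev[of u] ev[of v] by (simp add: div_add)
      then have "q ^ (u * v) * q powi ((int u - int v) * ((int u - int v) - 1) div 2)
          = q ^ v * q ^ (u choose 2) * q ^ (v choose 2)"
        using q by (simp add: power_int_add power_int_diff power_choose_two del: of_nat_mult)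
      moreover have "(- z) powi (int u - int v) = (- z) ^ u / (- z) ^ v"
        using z by (simp add: power_int_diff)
      moreover have "(- (q / z)) ^ v = q ^ v / (- z) ^ v"
        by (metis minus_divide_right power_divide)
      ultimately show ?thesis
        by (simp add: \<gamma>_def)
    qed
    then show ?thesis by (auto simp: fun_eq_iff)
  qed
  finally have "infsum \<gamma> UNIV / qpoch_inf q q = qpoch_inf z q * qpoch_inf (q / z) q"
    using durfee_rearrangement[OF q(1) \<gamma>] has_sum_unique by blast
  then have "infsum \<gamma> UNIV = qpoch_inf z q * qpoch_inf (q / z) q * qpoch_inf q q"
    using qpoch_inf_self_nonzero[OF q(1)] by (simp add: field_simps)
  with \<gamma> have "(\<gamma> has_sum qpoch_inf z q * qpoch_inf (q / z) q * qpoch_inf q q) UNIV"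
    by (simp only:)
  then show ?thesis
    unfolding \<gamma>_def .
qed

subsection \<open>The quintuple product\<close>

text \<open>Sort the first \<open>3 * n\<close> factors by the residue of their exponent modulo 3
  and pass to the limit.\<close>

lemma qpoch_inf_dissect3:
  fixes q :: complex
  assumes q: "norm q < 1"
  shows "qpoch_inf q (q ^ 3) * qpoch_inf (q ^ 2) (q ^ 3) * qpoch_inf (q ^ 3) (q ^ 3) = qpoch_inf q q"
proof -
  have fin: "qpoch q (q ^ 3) n * qpoch (q ^ 2) (q ^ 3) n * qpoch (q ^ 3) (q ^ 3) n = qpoch q q (3 * n)" for n
  proof (induction n)
    case (Suc n)
    have "q * (q ^ 3) ^ n = q * q ^ (3 * n)" "q ^ 2 * (q ^ 3) ^ n = q * q ^ Suc (3 * n)"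
      "q ^ 3 * (q ^ 3) ^ n = q * q ^ Suc (Suc (3 * n))"
      by (simp_all add: power_mult power2_eq_square power3_eq_cube)
    moreover have "3 * Suc n = Suc (Suc (Suc (3 * n)))" by simp
    ultimately show ?case
      using Suc.IH[symmetric] by (simp only: qpoch_Suc mult_ac)
  qed simp
  have q3: "norm (q ^ 3) < 1"
    using q by (simp add: norm_power power_less_one_iff)
  have "(\<lambda>n. qpoch q (q ^ 3) n * qpoch (q ^ 2) (q ^ 3) n * qpoch (q ^ 3) (q ^ 3) n)
          \<longlonglongrightarrow> qpoch_inf q (q ^ 3) * qpoch_inf (q ^ 2) (q ^ 3) * qpoch_inf (q ^ 3) (q ^ 3)"
    by (intro tendsto_mult qpoch_LIMSEQ q3)
  moreover have "(\<lambda>n. qpoch q q (3 * n)) \<longlonglongrightarrow> qpoch_inf q q"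
    by (rule filterlim_compose[OF qpoch_LIMSEQ[OF q]]) (simp add: filterlim_subseq strict_mono_def)
  ultimately show ?thesis
    unfolding fin by (rule LIMSEQ_unique)
qed

text \<open>The factor \<open>k = 0\<close> vanishes. This is why every third coefficient of the
  quintuple product is zero.\<close>

lemma qpoch_inf_one_eq_0:
  assumes "norm q < 1"
  shows "qpoch_inf 1 q = 0"
proof -
  have "qpoch 1 q (Suc n) = 0" for n
    by (simp add: qpoch_def prod.lessThan_Suc_shift del: prod.lessThan_Suc)
  then have "(\<lambda>n. qpoch 1 q (Suc n)) \<longlonglongrightarrow> 0"
    by simp
  then have "qpoch 1 q \<longlonglongrightarrow> 0"
    by (rule LIMSEQ_imp_Suc)
  then show ?thesis
    using qpoch_LIMSEQ[OF assms] LIMSEQ_unique by blast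
qed

text \<open>General term of the quintuple product series, indexed by the exponent of
  \<open>z\<close>. In the two residue classes with nonzero sign, 6 divides
  \<open>n * (n - 1)\<close>, so the division is exact.\<close>

definition quint :: "complex \<Rightarrow> complex \<Rightarrow> int \<Rightarrow> complex" where
  "quint z q n = (if n mod 3 = 0 then 1 else if n mod 3 = 1 then - 1 else 0)
                   * (z powi n * q powi (n * (n - 1) div 6))"

text \<open>Shifting \<open>b\<close> by \<open>n div 3\<close> replaces \<open>n\<close> by its
  residue \<open>i\<close>, up to a monomial. As
  \<open>3b^2 + b - 2ib = 6 * b(b-1)/2 + (4-2i) * b\<close>, the triple product of base
  \<open>q^6\<close> at \<open>q^(4-2i)\<close> applies: for \<open>i = 0, 1\<close> its factors
  reassemble to base \<open>q^2\<close>, and for \<open>i = 2\<close> its argument is 1.\<close>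

lemma quint_inner_sum:
  fixes q :: complex
  assumes q: "norm q < 1" "q \<noteq> 0"
  shows "((\<lambda>b::int. (- 1) powi b * q powi (3 * b * b + b - 2 * n * b)) has_sum
           (if n mod 3 = 2 then 0 else (- 1) powi (n div 3) * q powi (- (n div 3) * (3 * (n div 3) + 2 * (n mod 3) - 1))
              * qpoch_inf (q ^ 2) (q ^ 2))) UNIV"
proof -
  define k i where "k = n div 3" and "i = n mod 3"
  have n: "n = 3 * k + i" by (simp add: k_def i_def)
  have "i \<in> {0, 1, 2}" by (auto simp: i_def)
  have norm_q: "norm (q ^ m) < 1" if "m > 0" for m
    using q that by (simp add: norm_power power_less_one_iff)
  have theta: "((\<lambda>b::int. (- 1) powi b * q powi (3 * b * b + b - 2 * i * b)) has_sum
      qpoch_inf (q powi (4 - 2 * i)) (q ^ 6) * qpoch_inf (q powi (2 + 2 * i)) (q ^ 6) * qpoch_inf (q ^ 6) (q ^ 6)) UNIV"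
  proof -
    have 1: "(- (q powi (4 - 2 * i))) powi b * (q ^ 6) powi (b * (b - 1) div 2)
        = (- 1) powi b * q powi (3 * b * b + b - 2 * i * b)" for b
    proof -
      have "(- (q powi (4 - 2 * i))) powi b = (- 1) powi b * q powi ((4 - 2 * i) * b)"
        by (metis mult_minus1 power_int_mult power_int_mult_distrib)
      moreover have "(q ^ 6) powi (b * (b - 1) div 2) = q powi (3 * b * (b - 1))"
      proof -
        have "even (b * (b - 1))" by simp
        then have "6 * (b * (b - 1) div 2) = 3 * b * (b - 1)" by (simp add: mult.assoc)
        then show ?thesis
          by (metis of_nat_numeral power_int_mult power_int_of_nat)
      qed
      ultimately show ?thesis
        using q by (simp add: algebra_simps flip: power_int_add)
    qed
    have 2: "q ^ 6 / q powi (4 - 2 * i) = q powi (2 + 2 * i)"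
    proof -
      have "q powi (2 + 2 * i) * q powi (4 - 2 * i) = q powi 6"
        using q by (simp flip: power_int_add)
      then show ?thesis using q by (simp add: field_simps)
    qed
    show ?thesis
      using jacobi_triple_product[of "q ^ 6" "q powi (4 - 2 * i)"] q norm_q[of 6]
      by (simp only: 1 2) simp
  qed
  have val: "qpoch_inf (q powi (4 - 2 * i)) (q ^ 6) * qpoch_inf (q powi (2 + 2 * i)) (q ^ 6) * qpoch_inf (q ^ 6) (q ^ 6)
     = (if i = 2 then 0 else qpoch_inf (q ^ 2) (q ^ 2))"
    using \<open>i \<in> {0, 1, 2}\<close> qpoch_inf_dissect3[OF norm_q[of 2]] qpoch_inf_one_eq_0[OF norm_q[of 6]]
    by (auto simp: mult_ac simp flip: power_mult)
  have "((\<lambda>b::int. (- 1) powi (b + k) * q powi (3 * (b + k) * (b + k) + (b + k) - 2 * n * (b + k))) has_sum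
      (- 1) powi k * q powi (- k * (3 * k + 2 * i - 1)) * (if i = 2 then 0 else qpoch_inf (q ^ 2) (q ^ 2))) UNIV"
  proof -
    have "(- 1) powi (b + k) * q powi (3 * (b + k) * (b + k) + (b + k) - 2 * n * (b + k))
       = (- 1) powi k * q powi (- k * (3 * k + 2 * i - 1)) * ((- 1) powi b * q powi (3 * b * b + b - 2 * i * b))" for b
    proof -
      have "3 * (b + k) * (b + k) + (b + k) - 2 * n * (b + k)
          = - k * (3 * k + 2 * i - 1) + (3 * b * b + b - 2 * i * b)"
        by (simp add: n algebra_simps)
      then show ?thesis
        using q by (simp only: power_int_add simp_thms) (simp add: power_int_add)
    qed
    then show ?thesis
      using has_sum_cmult_right[OF theta[unfolded val]] by simp
  qed
  then have "((\<lambda>b::int. (- 1) powi b * q powi (3 * b * b + b - 2 * n * b)) has_sum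
      (- 1) powi k * q powi (- k * (3 * k + 2 * i - 1)) * (if i = 2 then 0 else qpoch_inf (q ^ 2) (q ^ 2))) UNIV"
    by (subst has_sum_reindex_bij_betw[OF bij_plus_right, of _ k, symmetric])
  then show ?thesis
    unfolding k_def i_def by (auto split: if_splits)
qed

text \<open>Multiply the triple products for \<open>(z, q)\<close> and \<open>(q z\<^sup>2, q\<^sup>2)\<close> and collect the powers of \<open>z\<close>: each
  coefficient is again a triple product, of base \<open>q\<^sup>6\<close>, which is \<open>(q\<^sup>2; q\<^sup>2)\<^sub>\<infinity>\<close> up to a monomial or zero.\<close>

theorem quintuple_product:
  fixes q z :: complex
  assumes q: "norm q < 1" "q \<noteq> 0" and z: "z \<noteq> 0"
  shows "(quint z q has_sum qpoch_inf z q * qpoch_inf (q / z) q * qpoch_inf q q *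
           (qpoch_inf (q * z ^ 2) (q ^ 2) * qpoch_inf (q / z ^ 2) (q ^ 2))) UNIV"
proof -
  have q2: "norm (q ^ 2) < 1" "q ^ 2 \<noteq> 0"
    using q by (simp_all add: norm_power power_less_one_iff)
  define P where "P = qpoch_inf z q * qpoch_inf (q / z) q * qpoch_inf q q"
  define R where "R = qpoch_inf (q * z ^ 2) (q ^ 2) * qpoch_inf (q / z ^ 2) (q ^ 2)"
  define E where "E = qpoch_inf (q ^ 2) (q ^ 2)"
  have E: "E \<noteq> 0" unfolding E_def by (rule qpoch_inf_self_nonzero[OF q2(1)])
  define f where "f a = (- z) powi a * q powi (a * (a - 1) div 2)" for a :: int
  define g where "g b = (- 1) powi b * z powi (2 * b) * q powi (b * b)" for b :: int
  have f: "(f has_sum P) UNIV"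
    unfolding f_def P_def by (rule jacobi_triple_product[OF q z])
  have g: "(g has_sum R * E) UNIV"
  proof -
    have "(- (q * z ^ 2)) powi b * (q ^ 2) powi (b * (b - 1) div 2) = g b" for b
    proof -
      have "even (b * (b - 1))" by simp
      then have "2 * (b * (b - 1) div 2) = b * (b - 1)" by simp
      then have "(q ^ 2) powi (b * (b - 1) div 2) = q powi (b * (b - 1))"
        by (metis of_nat_numeral power_int_mult power_int_of_nat)
      moreover have "(- (q * z ^ 2)) powi b = (- 1) powi b * (q powi b * z powi (2 * b))"
        by (metis mult_minus1 of_nat_numeral power_int_mult power_int_mult_distrib power_int_of_nat)
      moreover have "q powi b * q powi (b * (b - 1)) = q powi (b * b)"
        using q by (simp add: algebra_simps flip: power_int_add)
      ultimately show ?thesis by (simp add: g_def mult_ac)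
    qed
    moreover have "q ^ 2 / (q * z ^ 2) = q / z ^ 2"
      using q by (simp add: power2_eq_square)
    ultimately show ?thesis
      using jacobi_triple_product[OF q2, of "q * z ^ 2"] q z by (simp add: R_def E_def)
  qed
  have "((\<lambda>(a, b). f a * g b) has_sum P * (R * E)) UNIV"
    by (rule has_sum_product_UNIV[OF f g])
  \<comment> \<open>\<open>n = a + 2 * b\<close> is the total exponent of \<open>z\<close>.\<close>
  also have "?this \<longleftrightarrow> ((\<lambda>(n, b). f (n - 2 * b) * g b) has_sum P * (R * E)) (UNIV \<times> UNIV)"
    by (rule has_sum_reindex_bij_witness[of _ "\<lambda>(n, b). (n - 2 * b, b)" "\<lambda>(a, b). (a + 2 * b, b)"]) auto
  finally have fg: "((\<lambda>(n, b). f (n - 2 * b) * g b) has_sum P * (R * E)) (UNIV \<times> UNIV)" .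
  have inner: "((\<lambda>b. f (n - 2 * b) * g b) has_sum quint z q n * E) UNIV" for n
  proof -
    have term_eq: "f (n - 2 * b) * g b = f n * ((- 1) powi b * q powi (3 * b * b + b - 2 * n * b))" for b
    proof -
      have "(n - 2 * b) * (n - 2 * b - 1) = n * (n - 1) + (2 * b * b + b - 2 * n * b) * 2"
        by (simp add: algebra_simps)
      then have "(n - 2 * b) * (n - 2 * b - 1) div 2 = n * (n - 1) div 2 + (2 * b * b + b - 2 * n * b)"
        by simp
      then have "(n - 2 * b) * (n - 2 * b - 1) div 2 + b * b = n * (n - 1) div 2 + (3 * b * b + b - 2 * n * b)"
        by simp
      then have "q powi ((n - 2 * b) * (n - 2 * b - 1) div 2) * q powi (b * b)
          = q powi (n * (n - 1) div 2) * q powi (3 * b * b + b - 2 * n * b)"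
        using q by (metis power_int_add)
      moreover have "(- z) powi (n - 2 * b) * z powi (2 * b) = (- z) powi n"
        using z by (simp add: power_int_diff power_int_minus_left)
      moreover have "f (n - 2 * b) * g b = (- 1) powi b * ((- z) powi (n - 2 * b) * z powi (2 * b))
          * (q powi ((n - 2 * b) * (n - 2 * b - 1) div 2) * q powi (b * b))"
        by (simp add: f_def g_def)
      ultimately show ?thesis
        by (simp add: f_def)
    qed
    define k i where "k = n div 3" and "i = n mod 3"
    have n: "n = 3 * k + i" by (simp add: k_def i_def)
    have "i \<in> {0, 1, 2}" by (auto simp: i_def)
    have "f n * (if i = 2 then 0 else (- 1) powi k * q powi (- k * (3 * k + 2 * i - 1)) * E) = quint z q n * E"
    proof (cases "i = 2")
      case False
      then have i: "i = 0 \<or> i = 1" using \<open>i \<in> {0, 1, 2}\<close> by auto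
      have "3 * (n * (n - 1) div 6) = n * (n - 1) div 2"
      proof -
        have "6 dvd n * (n - 1)"
        proof -
          have "2 dvd n * (n - 1)" by simp
          moreover have "3 dvd n * (n - 1)" using i by (auto simp: n)
          moreover have "coprime (2::int) 3" by simp
          ultimately have "2 * 3 dvd n * (n - 1)" by (rule divides_mult)
          then show ?thesis by simp
        qed
        then show ?thesis by auto
      qed
      moreover have "n * (n - 1) div 2 + - k * (3 * k + 2 * i - 1) = n * (n - 1) div 6"
      proof -
        have "n * (n - 1) = 3 * (k * (3 * k + 2 * i - 1))" using i by (auto simp: n algebra_simps)
        then show ?thesis using calculation by simp
      qed
      ultimately have "q powi (n * (n - 1) div 2) * q powi (- k * (3 * k + 2 * i - 1)) = q powi (n * (n - 1) div 6)"
        using q by (simp flip: power_int_add)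
      moreover have "(- z) powi n * (- 1) powi k = (if i = 0 then 1 else - 1) * z powi n"
        using i by (auto simp: power_int_minus_left n)
      ultimately show ?thesis
        using i by (auto simp: f_def quint_def i_def[symmetric] mult_ac)
    qed (simp add: quint_def flip: i_def)
    then show ?thesis
      using has_sum_cmult_right[OF quint_inner_sum[OF q, of n], of "f n"]
      unfolding term_eq E_def k_def i_def by simp
  qed
  have "((\<lambda>n. quint z q n * E) has_sum P * R * E) UNIV"
    using has_sum_SigmaD[OF fg] inner by (simp add: mult.assoc)
  then show ?thesis
    using E by (subst (asm) has_sum_cmult_left_iff) (auto simp: P_def R_def)
qed

subsection \<open>Two Bailey pairs\<close>

text \<open>The sign is even about \<open>1/2\<close> (\<open>eps_minus\<close>) and odd about
  \<open>-1\<close> (\<open>eps_antisym\<close>); the recurrences for the two Bailey pairs rest on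
  these reflections.\<close>

definition eps :: "int \<Rightarrow> complex" where
  "eps r = (if r mod 6 \<in> {0, 1} then 1 else if r mod 6 \<in> {3, 4} then - 1 else 0)"

lemma eps_minus: "eps (- r) = eps (r + 1)"
proof -
  have "r mod 6 \<in> {0, 1, 2, 3, 4, 5}" by auto
  then show ?thesis
    unfolding eps_def by (auto simp: zmod_zminus1_eq_if mod_add_left_eq[of r 6 1, symmetric] simp del: mod_add_left_eq)
qed

lemma eps_antisym: "eps (- r - 1) = - eps (r - 1)"
proof -
  have "(- r - 1) mod 6 = 0 \<or> (- r - 1) mod 6 = 1 \<longleftrightarrow> (r - 1) mod 6 = 3 \<or> (r - 1) mod 6 = 4"
       "(- r - 1) mod 6 = 3 \<or> (- r - 1) mod 6 = 4 \<longleftrightarrow> (r - 1) mod 6 = 0 \<or> (r - 1) mod 6 = 1"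
    by presburger+
  then show ?thesis
    unfolding eps_def by auto
qed

definition two_one_sum :: "complex \<Rightarrow> (nat \<Rightarrow> complex) \<Rightarrow> nat \<Rightarrow> complex" where
  "two_one_sum q a M = (\<Sum>j\<le>M div 2. a (M - 2 * j) / (qpoch q q (M - 2 * j) * qpoch q q j))"

text \<open>Bailey's relation in bilateral form: the weight depends on \<open>r = u - v\<close> with
  \<open>u + v = M\<close>, so \<open>r\<close> runs through both signs and \<open>M\<close> may
  have either parity.\<close>

definition bailey_sum :: "complex \<Rightarrow> (int \<Rightarrow> complex) \<Rightarrow> nat \<Rightarrow> complex" where
  "bailey_sum q c M = (\<Sum>u\<le>M. c (int u - int (M - u)) / (qpoch q q u * qpoch q q (M - u)))"

section \<open>Lowering one index of a finite sum\<close>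

lemma qpoch_self_Suc_cancel:
  assumes "norm q < 1"
  shows "(1 - q ^ Suc n) / qpoch q q (Suc n) = 1 / qpoch q q n"
  using one_minus_power_nonzero[OF assms, of "Suc n"] by (simp add: qpoch_Suc)

lemma bailey_sum_reflect: "bailey_sum q (\<lambda>r. c (- r)) M = bailey_sum q c M"
  unfolding bailey_sum_def
  by (rule sum.reindex_bij_witness[of _ "\<lambda>u. M - u" "\<lambda>u. M - u"]) (auto simp: mult.commute)

text \<open>The factor \<open>1 - q^u\<close> kills the term \<open>u = 0\<close> and otherwise
  turns \<open>1/(q;q)_u\<close> into \<open>1/(q;q)_(u-1)\<close>. Renaming \<open>u\<close> raises
  the difference \<open>u - v\<close> by one.\<close>

lemma bailey_sum_lower_u:
  assumes "norm q < 1"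
  shows "(\<Sum>u\<le>Suc M. (1 - q ^ u) * c (int u - int (Suc M - u)) / (qpoch q q u * qpoch q q (Suc M - u)))
       = bailey_sum q (\<lambda>r. c (r + 1)) M"
proof -
  have "(1 - q ^ Suc u) * c (int (Suc u) - int (M - u)) / (qpoch q q (Suc u) * qpoch q q (M - u))
      = c (int u - int (M - u) + 1) / (qpoch q q u * qpoch q q (M - u))" for u
  proof -
    have "(1 - q ^ Suc u) * c (int (Suc u) - int (M - u)) / (qpoch q q (Suc u) * qpoch q q (M - u))
      = (1 - q ^ Suc u) / qpoch q q (Suc u) * (c (int (Suc u) - int (M - u)) / qpoch q q (M - u))"
      by (simp del: power_Suc)
    then show ?thesis
      by (simp only: qpoch_self_Suc_cancel[OF assms]) (simp add: algebra_simps)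
  qed
  note key = this
  have "(\<Sum>u\<le>Suc M. (1 - q ^ u) * c (int u - int (Suc M - u)) / (qpoch q q u * qpoch q q (Suc M - u)))
      = (\<Sum>u\<le>M. (1 - q ^ Suc u) * c (int (Suc u) - int (M - u)) / (qpoch q q (Suc u) * qpoch q q (M - u)))"
    by (subst sum.atMost_Suc_shift) (simp del: power_Suc of_nat_Suc)
  then show ?thesis
    by (simp only: key bailey_sum_def)
qed

lemma bailey_sum_lower_v:
  assumes "norm q < 1"
  shows "(\<Sum>u\<le>Suc M. (1 - q ^ (Suc M - u)) * c (int u - int (Suc M - u)) / (qpoch q q u * qpoch q q (Suc M - u)))
       = bailey_sum q (\<lambda>r. c (r - 1)) M"
proof -
  have "(\<Sum>u\<le>Suc M. (1 - q ^ (Suc M - u)) * c (int u - int (Suc M - u)) / (qpoch q q u * qpoch q q (Suc M - u)))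
      = (\<Sum>u\<le>Suc M. (1 - q ^ u) * c (- (int u - int (Suc M - u))) / (qpoch q q u * qpoch q q (Suc M - u)))"
    by (rule sum.reindex_bij_witness[of _ "\<lambda>u. Suc M - u" "\<lambda>u. Suc M - u"]) (auto simp: algebra_simps)
  also have "\<dots> = bailey_sum q (\<lambda>r. c (- (r + 1))) M"
    by (rule bailey_sum_lower_u[OF assms, of "\<lambda>r. c (- r)"])
  also have "\<dots> = bailey_sum q (\<lambda>r. c (- (- r + 1))) M"
    by (rule bailey_sum_reflect[symmetric])
  finally show ?thesis by simp
qed

lemma two_one_sum_lower_m:
  assumes "norm q < 1"
  shows "(\<Sum>j\<le>Suc M div 2. (1 - q ^ (Suc M - 2 * j)) * a (Suc M - 2 * j) / (qpoch q q (Suc M - 2 * j) * qpoch q q j))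
       = two_one_sum q (\<lambda>m. a (Suc m)) M"
proof -
  \<comment> \<open>For odd \<open>M\<close> the range loses its last \<open>j\<close>, where
    \<open>Suc M - 2 * j = 0\<close> makes the factor vanish.\<close>
  have "(\<Sum>j\<le>Suc M div 2. (1 - q ^ (Suc M - 2 * j)) * a (Suc M - 2 * j) / (qpoch q q (Suc M - 2 * j) * qpoch q q j))
      = (\<Sum>j\<le>M div 2. (1 - q ^ (Suc M - 2 * j)) * a (Suc M - 2 * j) / (qpoch q q (Suc M - 2 * j) * qpoch q q j))"
  proof (rule sum.mono_neutral_right)
    show "\<forall>j\<in>{..Suc M div 2} - {..M div 2}.
       (1 - q ^ (Suc M - 2 * j)) * a (Suc M - 2 * j) / (qpoch q q (Suc M - 2 * j) * qpoch q q j) = 0"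
    proof
      fix j assume "j \<in> {..Suc M div 2} - {..M div 2}"
      then have "Suc M - 2 * j = 0" by auto
      then show "(1 - q ^ (Suc M - 2 * j)) * a (Suc M - 2 * j) / (qpoch q q (Suc M - 2 * j) * qpoch q q j) = 0"
        by simp
    qed
  qed auto
  also have "\<dots> = two_one_sum q (\<lambda>m. a (Suc m)) M"
    unfolding two_one_sum_def
  proof (rule sum.cong)
    fix j assume "j \<in> {..M div 2}"
    then have "Suc M - 2 * j = Suc (M - 2 * j)" by auto
    moreover have "(1 - q ^ Suc m) * x / (qpoch q q (Suc m) * y) = x / (qpoch q q m * y)" for m x y
      using arg_cong[OF qpoch_self_Suc_cancel[OF assms, of m], of "\<lambda>w. w * (x / y)"] by simp
    ultimately show "(1 - q ^ (Suc M - 2 * j)) * a (Suc M - 2 * j) / (qpoch q q (Suc M - 2 * j) * qpoch q q j)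
        = a (Suc (M - 2 * j)) / (qpoch q q (M - 2 * j) * qpoch q q j)"
      by simp
  qed simp
  finally show ?thesis .
qed

lemma two_one_sum_lower_j:
  assumes "norm q < 1"
  shows "(\<Sum>j\<le>Suc (Suc M) div 2. (1 - q ^ j) * a (Suc (Suc M) - 2 * j) / (qpoch q q (Suc (Suc M) - 2 * j) * qpoch q q j))
       = two_one_sum q a M"
proof -
  have "(1 - q ^ Suc m) * x / (y * qpoch q q (Suc m)) = x / (y * qpoch q q m)" for m x y
    using arg_cong[OF qpoch_self_Suc_cancel[OF assms, of m], of "\<lambda>w. w * (x / y)"] by (simp add: mult.commute)
  then show ?thesis
    unfolding two_one_sum_def
    by (simp add: sum.atMost_Suc_shift del: power_Suc sum.atMost_Suc)
qed

text \<open>\<open>eps r\<close> vanishes for \<open>r \<equiv> 2\<close> modulo 3, so the divisions by 3 are exact wherever they matter.\<close>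

definition cA :: "complex \<Rightarrow> int \<Rightarrow> complex" where
  "cA t r = eps r * t powi (2 * r * (r - 1) div 3)"

definition cB :: "complex \<Rightarrow> int \<Rightarrow> complex" where
  "cB t r = eps r * t powi (r * (2 * r + 1) div 3)"

text \<open>For \<open>r = u - v\<close> and \<open>u + v = M\<close>, one has
  \<open>t^M * t^r = q^u\<close> and \<open>t^M / t^r = q^v\<close>. Hence multiplication by
  \<open>t^M\<close> exchanges the two weights up to \<open>q^u\<close> or
  \<open>q^v\<close>.\<close>

lemma cB_eq_cA:
  assumes "t \<noteq> 0"
  shows "cB t r = t powi r * cA t r"
proof -
  have "r * (2 * r + 1) = 2 * r * (r - 1) + r * 3"
    by (simp add: algebra_simps)
  then have "r * (2 * r + 1) div 3 = 2 * r * (r - 1) div 3 + r"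
    by simp
  then show ?thesis
    using assms by (simp add: cA_def cB_def power_int_add)
qed

lemma cA_minus: "cA t (- r) = cA t (r + 1)"
proof -
  have "2 * (- r) * (- r - 1) = 2 * (r + 1) * ((r + 1) - 1)"
    by (simp add: algebra_simps)
  then show ?thesis
    by (simp only: cA_def eps_minus)
qed

text \<open>Subtracting the \<open>cB\<close> sum inserts \<open>1 - q^u\<close> into the
  \<open>cA\<close> sum. Lowering \<open>u\<close> leaves the weight
  \<open>cA t (r + 1) = cA t (- r)\<close>, and swapping \<open>u\<close> and \<open>v\<close>
  restores \<open>cA\<close>.\<close>

lemma bailey_sum_A_step:
  assumes t: "t \<noteq> 0" "norm t < 1" and q: "q = t\<^sup>2"
  shows "bailey_sum q (cA t) (Suc M) = bailey_sum q (cA t) M + t ^ Suc M * bailey_sum q (cB t) (Suc M)"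
proof -
  have q1: "norm q < 1" using t by (simp add: q norm_power power_less_one_iff)
  have key: "t ^ Suc M * cB t (int u - int (Suc M - u)) = q ^ u * cA t (int u - int (Suc M - u))"
    if "u \<le> Suc M" for u
  proof -
    have "t ^ Suc M * t powi (int u - int (Suc M - u)) = t powi (int (Suc M) + (int u - int (Suc M - u)))"
      using t by (subst power_int_add) (simp_all del: power_Suc of_nat_Suc)
    also have "int (Suc M) + (int u - int (Suc M - u)) = int (2 * u)"
      using that by (simp add: of_nat_diff)
    finally show ?thesis
      using t by (simp add: cB_eq_cA q power_mult power_int_of_nat del: power_Suc of_nat_mult flip: mult.assoc)
  qed
  have "bailey_sum q (cA t) (Suc M) - t ^ Suc M * bailey_sum q (cB t) (Suc M)
      = (\<Sum>u\<le>Suc M. (1 - q ^ u) * cA t (int u - int (Suc M - u)) / (qpoch q q u * qpoch q q (Suc M - u)))"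
    unfolding bailey_sum_def sum_distrib_left sum_subtractf[symmetric]
    by (rule sum.cong) (simp_all only: times_divide_eq_right key atMost_iff left_diff_distrib diff_divide_distrib mult_1)
  also have "\<dots> = bailey_sum q (\<lambda>r. cA t (r + 1)) M"
    by (rule bailey_sum_lower_u[OF q1])
  also have "\<dots> = bailey_sum q (cA t) M"
    using bailey_sum_reflect[of q "cA t" M] by (simp add: cA_minus)
  finally show ?thesis by (simp add: algebra_simps)
qed

text \<open>The weights \<open>t\<^sup>r * cB t (r - 1)\<close> are odd in \<open>r\<close>, so they sum to zero against the symmetric
  kernel; this is what allows \<open>1 - q ^ u\<close> to be inserted for free.\<close>

lemma bailey_sum_shifted_B:
  assumes t: "t \<noteq> 0" "norm t < 1" and q: "q = t\<^sup>2"
  shows "bailey_sum q (\<lambda>r. cB t (r - 1)) (Suc M) = bailey_sum q (cB t) M"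
proof -
  have q1: "norm q < 1" using t by (simp add: q norm_power power_less_one_iff)
  define e where "e r = t powi r * cB t (r - 1)" for r
  \<comment> \<open>In this form the exponent is visibly even in \<open>r\<close> and the sign
    odd.\<close>
  have e_alt: "e r = eps (r - 1) * t powi ((2 * r * r + 1) div 3)" for r
  proof -
    have "2 * r * r + 1 = (r - 1) * (2 * (r - 1) + 1) + r * 3"
      by (simp add: algebra_simps)
    then have "(2 * r * r + 1) div 3 = (r - 1) * (2 * (r - 1) + 1) div 3 + r"
      by simp
    then show ?thesis
      using t by (simp add: e_def cB_def power_int_add)
  qed
  have "e (- r) = - e r" for r
    unfolding e_alt by (simp add: eps_antisym)
  then have "bailey_sum q (\<lambda>r. - e r) (Suc M) = bailey_sum q e (Suc M)"
    using bailey_sum_reflect[of q e "Suc M"] by simp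
  moreover have "bailey_sum q (\<lambda>r. - e r) (Suc M) = - bailey_sum q e (Suc M)"
    by (simp add: bailey_sum_def sum_negf del: sum.atMost_Suc)
  ultimately have e0: "bailey_sum q e (Suc M) = 0"
    by simp
  have key: "q ^ u * cB t (int u - int (Suc M - u) - 1) = t ^ Suc M * e (int u - int (Suc M - u))"
    if "u \<le> Suc M" for u
  proof -
    have "t ^ Suc M * t powi (int u - int (Suc M - u)) = t powi (int (Suc M) + (int u - int (Suc M - u)))"
      using t by (subst power_int_add) (simp_all del: power_Suc of_nat_Suc)
    also have "int (Suc M) + (int u - int (Suc M - u)) = int (2 * u)"
      using that by (simp add: of_nat_diff)
    finally show ?thesis
      using t by (simp add: e_def q power_mult power_int_of_nat del: power_Suc of_nat_mult flip: mult.assoc)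
  qed
  have "bailey_sum q (\<lambda>r. cB t (r - 1)) (Suc M) - t ^ Suc M * bailey_sum q e (Suc M)
      = (\<Sum>u\<le>Suc M. (1 - q ^ u) * cB t (int u - int (Suc M - u) - 1) / (qpoch q q u * qpoch q q (Suc M - u)))"
    unfolding bailey_sum_def sum_distrib_left sum_subtractf[symmetric]
    by (rule sum.cong) (simp_all only: times_divide_eq_right key atMost_iff left_diff_distrib diff_divide_distrib mult_1)
  also have "\<dots> = bailey_sum q (\<lambda>r. cB t (r + 1 - 1)) M"
    by (rule bailey_sum_lower_u[OF q1, of "\<lambda>r. cB t (r - 1)"])
  finally show ?thesis by (simp add: e0)
qed

text \<open>Here \<open>t^M * cA\<close> becomes \<open>q^v * cB\<close>, so it is \<open>v\<close>
  that gets lowered.\<close>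

lemma bailey_sum_B_step:
  assumes t: "t \<noteq> 0" "norm t < 1" and q: "q = t\<^sup>2"
  shows "bailey_sum q (cB t) (Suc M) =
           t ^ Suc M * bailey_sum q (cA t) (Suc M) + bailey_sum q (\<lambda>r. cB t (r - 1)) M"
proof -
  have q1: "norm q < 1" using t by (simp add: q norm_power power_less_one_iff)
  have key: "t ^ Suc M * cA t (int u - int (Suc M - u)) = q ^ (Suc M - u) * cB t (int u - int (Suc M - u))"
    if "u \<le> Suc M" for u
  proof -
    have "q ^ (Suc M - u) * t powi (int u - int (Suc M - u)) = t powi (int (2 * (Suc M - u)) + (int u - int (Suc M - u)))"
      using t by (subst power_int_add) (simp_all only: q power_int_of_nat power_mult simp_thms)
    also have "int (2 * (Suc M - u)) + (int u - int (Suc M - u)) = int (Suc M)"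
      using that by (simp add: of_nat_diff)
    finally show ?thesis
      using t by (simp add: cB_eq_cA power_int_of_nat del: power_Suc of_nat_Suc flip: mult.assoc)
  qed
  have "bailey_sum q (cB t) (Suc M) - t ^ Suc M * bailey_sum q (cA t) (Suc M)
      = (\<Sum>u\<le>Suc M. (1 - q ^ (Suc M - u)) * cB t (int u - int (Suc M - u)) / (qpoch q q u * qpoch q q (Suc M - u)))"
    unfolding bailey_sum_def sum_distrib_left sum_subtractf[symmetric]
    by (rule sum.cong) (simp_all only: times_divide_eq_right key atMost_iff left_diff_distrib diff_divide_distrib mult_1)
  also have "\<dots> = bailey_sum q (\<lambda>r. cB t (r - 1)) M"
    by (rule bailey_sum_lower_v[OF q1])
  finally show ?thesis by (simp add: algebra_simps)
qed

text \<open>With \<open>t^2 = q\<close> this is \<open>q^(m(m-1)/2)\<close>, and \<open>aB\<close>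
  is \<open>q^(m^2/2)\<close>. The truncated \<open>m - 1\<close> at \<open>m = 0\<close> is
  multiplied by 0.\<close>

definition aA :: "complex \<Rightarrow> nat \<Rightarrow> complex" where
  "aA t m = t ^ (m * (m - 1))"

definition aB :: "complex \<Rightarrow> nat \<Rightarrow> complex" where
  "aB t m = t ^ (m * m)"

text \<open>With \<open>m = Suc M - 2 * j\<close>, the two sums differ by the factor
  \<open>1 - q^(j+m) = (1 - q^m) + q^m * (1 - q^j)\<close>. The first part lowers \<open>m\<close>
  and gives the \<open>a'\<close> sum at \<open>M\<close>; the second lowers \<open>j\<close> and
  gives \<open>R (Suc M)\<close>, which is the \<open>aA\<close> sum minus the \<open>a'\<close> sum
  at \<open>M\<close>.\<close>

lemma two_one_sum_A_step:
  assumes t: "norm t < 1" and q: "q = t\<^sup>2"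
  shows "two_one_sum q (aA t) (Suc M) = two_one_sum q (aA t) M + t ^ Suc M * two_one_sum q (aB t) (Suc M)"
proof -
  have q1: "norm q < 1" using t by (simp add: q norm_power power_less_one_iff)
  define a' where "a' m = q ^ m * aA t m" for m
  have a': "aA t (Suc m) = a' m" for m
  proof -
    have "Suc m * (Suc m - 1) = 2 * m + m * (m - 1)"
      by (cases m) auto
    then show ?thesis
      by (simp only: aA_def a'_def q power_add power_mult)
  qed
  have lower: "two_one_sum q a' M = (\<Sum>j\<le>Suc M div 2. (1 - q ^ (Suc M - 2 * j)) * aA t (Suc M - 2 * j)
      / (qpoch q q (Suc M - 2 * j) * qpoch q q j))" for M
    unfolding two_one_sum_lower_m[OF q1] a' ..
  define R where "R M = (\<Sum>j\<le>M div 2. (1 - q ^ j) * a' (M - 2 * j) / (qpoch q q (M - 2 * j) * qpoch q q j))" for M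
  have R: "R (Suc M) = two_one_sum q (aA t) M - two_one_sum q a' M"
  proof (cases M)
    case 0
    then show ?thesis by (simp add: R_def two_one_sum_def a'_def aA_def)
  next
    case (Suc N)
    have "two_one_sum q (aA t) M - two_one_sum q a' M
        = (\<Sum>j\<le>M div 2. (1 - q ^ (M - 2 * j)) * aA t (M - 2 * j) / (qpoch q q (M - 2 * j) * qpoch q q j))"
      unfolding two_one_sum_def sum_subtractf[symmetric]
      by (rule sum.cong) (simp_all only: a'_def left_diff_distrib diff_divide_distrib mult_1)
    also have "\<dots> = two_one_sum q a' N"
      unfolding Suc lower ..
    also have "\<dots> = R (Suc M)"
      unfolding R_def Suc two_one_sum_lower_j[OF q1] ..
    finally show ?thesis ..
  qed
  have key: "aA t (Suc M - 2 * j) - t ^ Suc M * aB t (Suc M - 2 * j)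
      = (1 - q ^ (Suc M - 2 * j)) * aA t (Suc M - 2 * j) + (1 - q ^ j) * a' (Suc M - 2 * j)"
    if "j \<le> Suc M div 2" for j
  proof -
    define m where "m = Suc M - 2 * j"
    have M: "Suc M = m + 2 * j" using that by (simp add: m_def)
    have "m + m * m = 2 * m + m * (m - 1)" by (cases m) auto
    then have "t ^ m * aB t m = q ^ m * aA t m"
      by (simp only: aA_def aB_def q flip: power_mult power_add)
    then have "t ^ Suc M * aB t m = q ^ j * (q ^ m * aA t m)"
      unfolding M by (simp add: power_add power_mult q)
    then show ?thesis
      unfolding m_def[symmetric] by (simp add: a'_def algebra_simps)
  qed
  have "two_one_sum q (aA t) (Suc M) - t ^ Suc M * two_one_sum q (aB t) (Suc M)
     = (\<Sum>j\<le>Suc M div 2. (aA t (Suc M - 2 * j) - t ^ Suc M * aB t (Suc M - 2 * j)) / (qpoch q q (Suc M - 2 * j) * qpoch q q j))"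
    unfolding two_one_sum_def sum_distrib_left sum_subtractf[symmetric]
    by (simp only: times_divide_eq_right diff_divide_distrib)
  also have "\<dots> = two_one_sum q a' M + R (Suc M)"
    unfolding R_def lower sum.distrib[symmetric]
    by (rule sum.cong) (simp_all only: key atMost_iff add_divide_distrib)
  finally show ?thesis
    unfolding R by (simp add: algebra_simps)
qed

text \<open>Termwise \<open>t^M * aA = q^j * aB\<close>, so the factor \<open>1 - q^j\<close>
  appears and lowers \<open>j\<close>, taking \<open>M\<close> to \<open>M - 2\<close>. For
  \<open>M < 2\<close> only \<open>j = 0\<close> occurs, and it contributes nothing.\<close>

lemma two_one_sum_B_step:
  assumes t: "norm t < 1" and q: "q = t\<^sup>2"
  shows "two_one_sum q (aB t) M - t ^ M * two_one_sum q (aA t) M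
       = (if M < 2 then 0 else two_one_sum q (aB t) (M - 2))"
proof -
  have q1: "norm q < 1" using t by (simp add: q norm_power power_less_one_iff)
  have key: "t ^ M * aA t (M - 2 * j) = q ^ j * aB t (M - 2 * j)" if "j \<le> M div 2" for j
  proof -
    define m where "m = M - 2 * j"
    have M: "M = m + 2 * j" using that by (simp add: m_def)
    have "m + m * (m - 1) = m * m" by (cases m) auto
    then have "t ^ m * aA t m = aB t m"
      by (simp add: aA_def aB_def flip: power_add)
    then show ?thesis
      unfolding m_def[symmetric] M by (simp add: power_add power_mult q)
  qed
  have "two_one_sum q (aB t) M - t ^ M * two_one_sum q (aA t) M
     = (\<Sum>j\<le>M div 2. (1 - q ^ j) * aB t (M - 2 * j) / (qpoch q q (M - 2 * j) * qpoch q q j))"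
    unfolding two_one_sum_def sum_distrib_left sum_subtractf[symmetric]
    by (rule sum.cong) (simp_all only: times_divide_eq_right key atMost_iff left_diff_distrib diff_divide_distrib mult_1)
  also have "\<dots> = (if M < 2 then 0 else two_one_sum q (aB t) (M - 2))"
  proof (cases "M < 2")
    case False
    then obtain N where "M = Suc (Suc N)"
      by (metis add_2_eq_Suc le_Suc_ex not_less)
    then show ?thesis
      using two_one_sum_lower_j[OF q1, of "aB t" N] by simp
  qed simp
  finally show ?thesis .
qed

text \<open>Both sides obey the same coupled recurrences. By induction the two discrepancies satisfy
  \<open>x = T * y\<close> and \<open>y = T * x\<close> with \<open>T * T = q^M\<close> different
  from 1, so both vanish.\<close>

theorem two_one_sum_eq_bailey_sum:
  assumes t: "t \<noteq> 0" "norm t < 1" and q: "q = t\<^sup>2"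
  shows "two_one_sum q (aA t) M = bailey_sum q (cA t) M"
    and "two_one_sum q (aB t) M = bailey_sum q (cB t) M"
proof -
  have q1: "norm q < 1" using t by (simp add: q norm_power power_less_one_iff)
  have "two_one_sum q (aA t) M = bailey_sum q (cA t) M \<and> two_one_sum q (aB t) M = bailey_sum q (cB t) M"
  proof (induction M rule: less_induct)
    case (less M)
    show ?case
    proof (cases M)
      case 0
      then show ?thesis
        by (simp add: two_one_sum_def bailey_sum_def aA_def aB_def cA_def cB_def eps_def)
    next
      case (Suc N)
      define T where "T = t ^ Suc N"
      define x where "x = two_one_sum q (aA t) (Suc N) - bailey_sum q (cA t) (Suc N)"
      define y where "y = two_one_sum q (aB t) (Suc N) - bailey_sum q (cB t) (Suc N)"
      have "two_one_sum q (aA t) N = bailey_sum q (cA t) N"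
        using less.IH[of N] Suc by simp
      then have x: "x = T * y"
        unfolding x_def y_def T_def two_one_sum_A_step[OF t(2) q, of N] bailey_sum_A_step[OF t q, of N]
        by (simp add: algebra_simps)
      \<comment> \<open>For \<open>N = 0\<close> the right side vanishes too, because
        \<open>eps (- 1) = 0\<close>.\<close>
      have "(if Suc N < 2 then 0 else two_one_sum q (aB t) (Suc N - 2)) = bailey_sum q (\<lambda>r. cB t (r - 1)) N"
      proof (cases N)
        case 0
        then show ?thesis by (simp add: bailey_sum_def cB_def eps_def)
      next
        case (Suc N')
        then show ?thesis
          using less.IH[of N'] \<open>M = Suc N\<close> bailey_sum_shifted_B[OF t q, of N'] by simp
      qed
      then have y: "y = T * x"
        using two_one_sum_B_step[OF t(2) q, of "Suc N"]
        unfolding x_def y_def T_def bailey_sum_B_step[OF t q, of N]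
        by (simp add: algebra_simps)
      have "1 - q ^ Suc N \<noteq> 0"
        using one_minus_power_nonzero[OF q1] by blast
      moreover have "T * T = q ^ Suc N"
        by (simp only: T_def q power2_eq_square power_mult_distrib)
      ultimately have "1 - T * T \<noteq> 0" by metis
      moreover have "(1 - T * T) * x = 0"
        using x y by (simp add: algebra_simps)
      ultimately have "x = 0" by simp
      with y show ?thesis by (simp add: x_def y_def Suc)
    qed
  qed
  then show "two_one_sum q (aA t) M = bailey_sum q (cA t) M" "two_one_sum q (aB t) M = bailey_sum q (cB t) M"
    by simp_all
qed

subsection \<open>Double sums and theta series\<close>

text \<open>Bounded denominators and the growth of \<open>e\<close> leave a product of two geometric
  series as majorant.\<close>

lemma double_sum_summable:
  fixes q :: complex
  assumes q: "norm q < 1" and e: "\<And>i j. i + j \<le> e i j"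
  shows "(\<lambda>(i, j). q ^ e i j / (qpoch q q (m i) * qpoch q q j)) summable_on UNIV"
proof -
  obtain C where C: "C > 0" "\<And>n. norm (1 / qpoch q q n) \<le> C"
    using qpoch_self_inverse_bounded[OF q] by blast
  have geo: "((\<lambda>n. norm q ^ n) has_sum 1 / (1 - norm q)) UNIV"
    using q by (intro norm_summable_imp_has_sum geometric_sums) (auto intro: summable_geometric)
  have "(\<lambda>(i, j). norm q ^ i * norm q ^ j) summable_on UNIV \<times> UNIV"
    by (rule summable_on_SigmaI[where g = "\<lambda>i. norm q ^ i * (1 / (1 - norm q))"])
       (auto intro!: has_sum_cmult_right geo summable_on_cmult_left has_sum_imp_summable[OF geo]
             simp del: times_divide_eq_right)
  then have "(\<lambda>ij. C\<^sup>2 * (case ij of (i, j) \<Rightarrow> norm q ^ i * norm q ^ j)) summable_on UNIV \<times> UNIV"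
    by (rule summable_on_cmult_right)
  then have "(\<lambda>ij. norm (case ij of (i, j) \<Rightarrow> q ^ e i j / (qpoch q q (m i) * qpoch q q j))) summable_on UNIV \<times> UNIV"
  proof (rule Infinite_Sum.abs_summable_on_comparison_test')
    fix ij :: "nat \<times> nat"
    obtain i j where [simp]: "ij = (i, j)" by (cases ij)
    have "norm (q ^ e i j / (qpoch q q (m i) * qpoch q q j))
        = norm (q ^ e i j) * (norm (1 / qpoch q q (m i)) * norm (1 / qpoch q q j))"
      by (simp add: norm_mult norm_divide)
    also have "\<dots> \<le> norm q ^ (i + j) * (C * C)"
      using C by (intro mult_mono norm_power_le q e mult_nonneg_nonneg) auto
    finally show "norm (case ij of (i, j) \<Rightarrow> q ^ e i j / (qpoch q q (m i) * qpoch q q j))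
        \<le> C\<^sup>2 * (case ij of (i, j) \<Rightarrow> norm q ^ i * norm q ^ j)"
      by (simp add: power2_eq_square power_add mult_ac)
  qed
  then show ?thesis
    using abs_summable_summable by fastforce
qed

lemma has_sum_group_two_one:
  fixes f :: "nat \<Rightarrow> nat \<Rightarrow> complex"
  assumes "((\<lambda>(m, j). f m j) has_sum S) UNIV"
  shows "((\<lambda>M. \<Sum>j\<le>M div 2. f (M - 2 * j) j) has_sum S) UNIV"
proof -
  have "((\<lambda>(M, j). f (M - 2 * j) j) has_sum S) (Sigma UNIV (\<lambda>M. {..M div 2}))
      \<longleftrightarrow> ((\<lambda>(m, j). f m j) has_sum S) UNIV"
    by (rule has_sum_reindex_bij_witness[of _ "\<lambda>(m, j). (m + 2 * j, j)" "\<lambda>(M, j). (M - 2 * j, j)"]) auto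
  then show ?thesis
    by (rule has_sum_SigmaD[OF iffD2[OF _ assms]]) (auto intro: has_sum_finiteI)
qed

lemma has_sum_group_antidiagonal:
  fixes f :: "nat \<Rightarrow> nat \<Rightarrow> complex"
  assumes "((\<lambda>(u, v). f u v) has_sum S) UNIV"
  shows "((\<lambda>M. \<Sum>u\<le>M. f u (M - u)) has_sum S) UNIV"
proof -
  have "((\<lambda>(M, u). f u (M - u)) has_sum S) (Sigma UNIV (\<lambda>M. {..M}))
      \<longleftrightarrow> ((\<lambda>(u, v). f u v) has_sum S) UNIV"
    by (rule has_sum_reindex_bij_witness[of _ "\<lambda>(u, v). (u + v, u)" "\<lambda>(M, u). (u, M - u)"]) auto
  then show ?thesis
    by (rule has_sum_SigmaD[OF iffD2[OF _ assms]]) (auto intro: has_sum_finiteI)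
qed

text \<open>The weight \<open>x\<close> restricts \<open>M\<close>, hence
  \<open>m = M - 2 * j\<close>, to the parity of \<open>p\<close>, so only
  \<open>m = 2 * i + p\<close> remains. The constant \<open>K\<close> absorbs a leftover power of
  \<open>t\<close>. Convergence comes from the growth of \<open>e\<close>, the value from uniqueness
  of sums.\<close>

lemma has_sum_double_eqI:
  fixes q K :: complex
  assumes q: "norm q < 1" and p: "p \<le> 1" and K: "K \<noteq> 0"
    and x0: "\<And>M. odd (M + p) \<Longrightarrow> x M = 0"
    and e: "\<And>i j. i + j \<le> e i j"
    and term_eq: "\<And>i j. x (2 * i + p + 2 * j) * a (2 * i + p) = K * q ^ e i j"
    and S: "((\<lambda>M. x M * two_one_sum q a M) has_sum K * S) UNIV"
  shows "((\<lambda>(i, j). q ^ e i j / (qpoch q q (2 * i + p) * qpoch q q j)) has_sum S) UNIV"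
proof -
  define T where "T = infsum (\<lambda>(i, j). q ^ e i j / (qpoch q q (2 * i + p) * qpoch q q j)) UNIV"
  have T: "((\<lambda>(i, j). q ^ e i j / (qpoch q q (2 * i + p) * qpoch q q j)) has_sum T) UNIV"
    unfolding T_def by (rule has_sum_infsum[OF double_sum_summable[OF q e, of "\<lambda>i. 2 * i + p"]])
  have inj: "inj (\<lambda>(i, j). (2 * i + p, j :: nat))"
    by (auto simp: inj_def)
  define f where "f m j = x (m + 2 * j) * a m / (qpoch q q m * qpoch q q j)" for m j
  have "((\<lambda>ij. K * (case ij of (i, j) \<Rightarrow> q ^ e i j / (qpoch q q (2 * i + p) * qpoch q q j))) has_sum K * T) UNIV"
    by (rule has_sum_cmult_right[OF T])
  also have "(\<lambda>ij. K * (case ij of (i, j) \<Rightarrow> q ^ e i j / (qpoch q q (2 * i + p) * qpoch q q j)))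
      = (\<lambda>(m, j). f m j) \<circ> (\<lambda>(i, j). (2 * i + p, j))"
    by (auto simp: fun_eq_iff f_def term_eq)
  finally have "((\<lambda>(m, j). f m j) has_sum K * T) (range (\<lambda>(i, j). (2 * i + p, j)))"
    by (simp only: has_sum_reindex[OF inj])
  also have "?this \<longleftrightarrow> ((\<lambda>(m, j). f m j) has_sum K * T) UNIV"
  proof (rule has_sum_cong_neutral)
    fix mj :: "nat \<times> nat"
    assume mj: "mj \<in> UNIV - range (\<lambda>(i, j). (2 * i + p, j))"
    obtain m j where [simp]: "mj = (m, j)" by (cases mj)
    have "odd (m + p)"
    proof
      assume "even (m + p)"
      then have "m = 2 * ((m - p) div 2) + p"
        using p by presburger
      then have "mj = (\<lambda>(i, j). (2 * i + p, j)) ((m - p) div 2, j)" by simp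
      with mj show False by blast
    qed
    then have "odd (m + 2 * j + p)" by simp
    then show "(case mj of (m, j) \<Rightarrow> f m j) = 0"
      using x0 by (simp add: f_def)
  qed auto
  finally have "((\<lambda>M. \<Sum>j\<le>M div 2. f (M - 2 * j) j) has_sum K * T) UNIV"
    by (rule has_sum_group_two_one)
  moreover have "(\<Sum>j\<le>M div 2. f (M - 2 * j) j) = x M * two_one_sum q a M" for M
    unfolding two_one_sum_def sum_distrib_left
    by (rule sum.cong) (auto simp: f_def)
  ultimately have "K * T = K * S"
    using S has_sum_unique by fastforce
  with K T show ?thesis by simp
qed

text \<open>This is \<open>q^(M^2/4)\<close> on one parity class, divided by \<open>q^(p/4)\<close>
  to make the exponent of \<open>t\<close> integral.\<close>

definition parity_weight :: "complex \<Rightarrow> nat \<Rightarrow> nat \<Rightarrow> complex" where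
  "parity_weight t p M = (if even (M + p) then t ^ ((M * M - p) div 2) else 0)"

text \<open>Since \<open>M^2 = 4 * u * v + (u - v)^2\<close>, the weight becomes
  \<open>q^(u * v)\<close> times a function of \<open>r = u - v\<close>, as the Durfee rearrangement
  requires. The progression \<open>b + 2 * s * n\<close> lists each \<open>r\<close> of the right
  parity once; its start and direction are left free to fit the quintuple product.\<close>

lemma bailey_lemma:
  assumes t: "t \<noteq> 0" "norm t < 1" and q: "q = t\<^sup>2" and p: "p \<le> 1"
    and r: "even (b + int p)" "s = 1 \<or> s = - 1"
    and F: "((\<lambda>n. t powi (((b + 2 * s * n) * (b + 2 * s * n) - int p) div 2) * c (b + 2 * s * n)) has_sum S) UNIV"
  shows "((\<lambda>M. parity_weight t p M * bailey_sum q c M) has_sum S / qpoch_inf q q) UNIV"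
proof -
  have q1: "norm q < 1" using t by (simp add: q norm_power power_less_one_iff)
  define \<gamma> where "\<gamma> r = (if even (r + int p) then t powi ((r * r - int p) div 2) * c r else 0)" for r
  have "((\<gamma> \<circ> (\<lambda>n. b + 2 * s * n)) has_sum S) UNIV"
    using F r(1) by (simp add: \<gamma>_def o_def)
  then have "(\<gamma> has_sum S) (range (\<lambda>n. b + 2 * s * n))"
    using r(2) by (subst has_sum_reindex) (auto simp: inj_def)
  also have "?this \<longleftrightarrow> (\<gamma> has_sum S) UNIV"
  proof (rule has_sum_cong_neutral)
    fix m assume m: "m \<in> UNIV - range (\<lambda>n. b + 2 * s * n)"
    have "odd (m + int p)"
    proof
      assume "even (m + int p)"
      with r(1) have "even (m - b)" by presburger
      then obtain k where k: "m = b + 2 * k"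
        by (metis add.commute diff_add_cancel evenE)
      have "m = b + 2 * s * (s * k)" using r(2) k by auto
      with m show False by blast
    qed
    then show "\<gamma> m = 0" by (simp add: \<gamma>_def)
  qed auto
  finally have "((\<lambda>(u, v). q ^ (u * v) * \<gamma> (int u - int v) / (qpoch q q u * qpoch q q v))
           has_sum S / qpoch_inf q q) UNIV"
    by (rule durfee_rearrangement[OF q1])
  then have "((\<lambda>M. \<Sum>u\<le>M. q ^ (u * (M - u)) * \<gamma> (int u - int (M - u)) / (qpoch q q u * qpoch q q (M - u)))
           has_sum S / qpoch_inf q q) UNIV"
    by (rule has_sum_group_antidiagonal)
  moreover have "q ^ (u * (M - u)) * \<gamma> (int u - int (M - u)) = parity_weight t p M * c (int u - int (M - u))"
    if "u \<le> M" for u M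
  proof -
    define v where "v = M - u"
    have M: "M = u + v" using that by (simp add: v_def)
    show ?thesis
    proof (cases "even (M + p)")
      case True
      then have par: "even (int u - int v + int p)" unfolding M by presburger
      have "even (M * M - p)" using True p by (auto simp: le_Suc_eq)
      have "p \<le> M * M" using True p by (cases M) auto
      have "int ((M * M - p) div 2) = (int M * int M - int p) div 2"
        using \<open>p \<le> M * M\<close> by (simp add: zdiv_int of_nat_diff)
      also have "int M * int M - int p = (int u - int v) * (int u - int v) - int p + 2 * int (2 * (u * v))"
        by (simp add: M algebra_simps)
      finally have "int ((M * M - p) div 2) = int (2 * (u * v)) + ((int u - int v) * (int u - int v) - int p) div 2"
        by simp
      then have "t ^ ((M * M - p) div 2) = t powi (int (2 * (u * v)) + ((int u - int v) * (int u - int v) - int p) div 2)"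
        by (metis power_int_of_nat)
      also have "\<dots> = q ^ (u * v) * t powi (((int u - int v) * (int u - int v) - int p) div 2)"
        using t by (subst power_int_add) (simp_all only: q power_int_of_nat power_mult simp_thms)
      finally show ?thesis
        unfolding v_def[symmetric] using True par by (simp add: \<gamma>_def parity_weight_def)
    next
      case False
      then have "odd (int u - int v + int p)" unfolding M by presburger
      then show ?thesis
        unfolding v_def[symmetric] using False by (simp add: \<gamma>_def parity_weight_def)
    qed
  qed
  then have "(\<Sum>u\<le>M. q ^ (u * (M - u)) * \<gamma> (int u - int (M - u)) / (qpoch q q u * qpoch q q (M - u)))
      = parity_weight t p M * bailey_sum q c M" for M
    unfolding bailey_sum_def sum_distrib_left
    by (intro sum.cong) auto
  ultimately show ?thesis by simp
qed

text \<open>The term \<open>M = 0\<close> vanishes by \<open>eps (- 1) = 0\<close>; all others are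
  \<open>bailey_sum_shifted_B\<close>. This serves the third family.\<close>

lemma bailey_lemma_shifted_B:
  assumes t: "t \<noteq> 0" "norm t < 1" and q: "q = t\<^sup>2"
    and S: "((\<lambda>M. x M * bailey_sum q (\<lambda>r. cB t (r - 1)) M) has_sum S) UNIV"
  shows "((\<lambda>M. x (Suc M) * bailey_sum q (cB t) M) has_sum S) UNIV"
proof -
  have "((\<lambda>M. x M * bailey_sum q (\<lambda>r. cB t (r - 1)) M) has_sum S) (range Suc)"
  proof (subst has_sum_cong_neutral[where T = UNIV and g = "\<lambda>M. x M * bailey_sum q (\<lambda>r. cB t (r - 1)) M"])
    fix M assume "M \<in> UNIV - range Suc"
    then have "M = 0" by (cases M) auto
    then show "x M * bailey_sum q (\<lambda>r. cB t (r - 1)) M = 0"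
      by (simp add: bailey_sum_def cB_def eps_def)
  qed (use S in auto)
  then show ?thesis
    by (subst (asm) has_sum_reindex) (auto simp: o_def bailey_sum_shifted_B[OF t q])
qed

section \<open>Evaluation by the quintuple product of base \<open>q^14\<close>\<close>

lemma quint_eqI:
  assumes t: "t \<noteq> 0" and q: "q = t\<^sup>2"
    and F0: "\<And>k. F (3 * k) = t powi (14 * k * (3 * k - 1) + 2 * int z * (3 * k) + \<kappa>)"
    and F1: "\<And>k. F (3 * k + 1) = - (t powi (14 * k * (3 * k + 1) + 2 * int z * (3 * k + 1) + \<kappa>))"
    and F2: "\<And>k. F (3 * k + 2) = 0"
  shows "F n = t powi \<kappa> * quint (q ^ z) (q ^ 14) n"
proof -
  define k i where "k = n div 3" and "i = n mod 3"
  have n: "n = 3 * k + i" by (simp add: k_def i_def)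
  have "i \<in> {0, 1, 2}" by (auto simp: i_def)
  have qz: "(q ^ z) powi m = t powi (2 * int z * m)" for m
    by (simp add: q power_int_mult flip: power_mult)
  have q14: "(q ^ 14) powi m = t powi (28 * m)" for m
    by (simp add: q power_int_mult flip: power_mult)
  \<comment> \<open>For \<open>n = 3k\<close> and \<open>n = 3k + 1\<close>, \<open>n(n-1)/6\<close>
    is \<open>k(3k-1)/2\<close> and \<open>k(3k+1)/2\<close>; parity makes these integers.\<close>
  have ev: "even (k * (3 * k - 1))" "even (k * (3 * k + 1))" by auto
  consider "i = 0" | "i = 1" | "i = 2" using \<open>i \<in> {0, 1, 2}\<close> by auto
  then show ?thesis
  proof cases
    case 1
    have "n * (n - 1) = 3 * (k * (3 * k - 1))" by (simp add: n 1)
    then have "28 * (n * (n - 1) div 6) = 14 * k * (3 * k - 1)"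
      using ev(1) by auto
    then show ?thesis
      using F0[of k] t by (simp add: quint_def qz q14 n 1 power_int_add mult_ac)
  next
    case 2
    have "n * (n - 1) = 3 * (k * (3 * k + 1))" by (simp add: n 2 algebra_simps)
    then have "28 * (n * (n - 1) div 6) = 14 * k * (3 * k + 1)"
      using ev(2) by auto
    then show ?thesis
      using F1[of k] t by (simp add: quint_def qz q14 n 2 power_int_add mult_ac)
  next
    case 3
    then show ?thesis
      using F2[of k] by (simp add: quint_def n)
  qed
qed

lemma eps_periodic: "eps (r + 6 * k) = eps r"
  by (simp add: eps_def)

text \<open>The quintuple product at base \<open>q^14\<close> and argument \<open>q^z\<close>. The
  subtractions are genuine for \<open>z \<le> 7\<close>.\<close>

definition mod14_product :: "complex \<Rightarrow> nat \<Rightarrow> complex" where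
  "mod14_product q z = qpochs_inf [q ^ z, q ^ (14 - z), q ^ 14] (q ^ 14)
                         * qpochs_inf [q ^ (14 - 2 * z), q ^ (14 + 2 * z)] (q ^ 28)"

lemma quint_has_sum_mod14_product:
  assumes q: "norm q < 1" "q \<noteq> 0" and z: "z \<le> 7"
  shows "(quint (q ^ z) (q ^ 14) has_sum mod14_product q z) UNIV"
proof -
  have "norm (q ^ 14) < 1" using q by (simp add: norm_power power_less_one_iff)
  moreover have "q ^ 14 / q ^ z = q ^ (14 - z)" "q ^ 14 * (q ^ z) ^ 2 = q ^ (14 + 2 * z)"
    "q ^ 14 / (q ^ z) ^ 2 = q ^ (14 - 2 * z)" "(q ^ 14) ^ 2 = q ^ 28"
    using q z by (simp_all add: power_diff power_add flip: power_mult) (simp_all add: mult.commute)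
  ultimately show ?thesis
    using quintuple_product[of "q ^ 14" "q ^ z"] q
    by (simp add: mod14_product_def qpochs_inf_def mult_ac)
qed

lemma power_int_mult_divs:
  fixes t :: complex
  assumes "t \<noteq> 0" "N = 3 * m" "L = 2 * (E - m)"
  shows "t powi (L div 2) * t powi (N div 3) = t powi E"
  using assms by (simp flip: power_int_add)

text \<open>Steps of \<open>2 * s\<close> through the 6-periodic sign give the pattern 1, -1, 0 of
  \<open>quint\<close>. It remains to compare exponents as polynomials in \<open>k\<close>;
  \<open>m0\<close> and \<open>m1\<close> are the exact thirds of \<open>N\<close> on the two
  nonzero classes.\<close>

lemma bailey_mod14:
  assumes t: "t \<noteq> 0" "norm t < 1" and q: "q = t\<^sup>2" and p: "p \<le> 1" and z: "z \<le> 7"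
    and b: "even (b + int p)" and s: "s = 1 \<or> s = - 1"
    and c: "\<And>r. c r = eps (r - \<delta>) * t powi (N r div 3)"
    and eps: "eps (b - \<delta>) = 1" "eps (b + 2 * s - \<delta>) = - 1" "eps (b + 4 * s - \<delta>) = 0"
    and N0: "\<And>k. N (b + 6 * s * k) = 3 * m0 k"
    and r0: "\<And>k. (b + 6 * s * k)\<^sup>2 - int p = 2 * (14 * k * (3 * k - 1) + 6 * int z * k + int \<kappa> - m0 k)"
    and N1: "\<And>k. N (b + 2 * s + 6 * s * k) = 3 * m1 k"
    and r1: "\<And>k. (b + 2 * s + 6 * s * k)\<^sup>2 - int p
               = 2 * (14 * k * (3 * k + 1) + 2 * int z * (3 * k + 1) + int \<kappa> - m1 k)"
  shows "((\<lambda>M. parity_weight t p M * bailey_sum q c M) has_sum t ^ \<kappa> * (mod14_product q z / qpoch_inf q q)) UNIV"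
proof -
  have q1: "norm q < 1" "q \<noteq> 0" using t by (simp_all add: q norm_power power_less_one_iff)
  define F where "F n = t powi (((b + 2 * s * n) * (b + 2 * s * n) - int p) div 2) * c (b + 2 * s * n)" for n
  have F: "F n = t powi int \<kappa> * quint (q ^ z) (q ^ 14) n" for n
  proof (rule quint_eqI[OF t(1) q])
    fix k
    have "b + 2 * s * (3 * k) = b + 6 * s * k" "b + 6 * s * k - \<delta> = b - \<delta> + 6 * (s * k)"
      by simp_all
    then have "F (3 * k) = t powi (((b + 6 * s * k)\<^sup>2 - int p) div 2) * t powi (N (b + 6 * s * k) div 3)"
      by (simp only: F_def c eps_periodic eps power2_eq_square mult_1)
    also have "\<dots> = t powi (14 * k * (3 * k - 1) + 6 * int z * k + int \<kappa>)"
      by (rule power_int_mult_divs[OF t(1) N0 r0])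
    also have "6 * int z * k = 2 * int z * (3 * k)"
      by simp
    finally show "F (3 * k) = t powi (14 * k * (3 * k - 1) + 2 * int z * (3 * k) + int \<kappa>)" .
    have "b + 2 * s * (3 * k + 1) = b + 2 * s + 6 * s * k" "b + 2 * s + 6 * s * k - \<delta> = b + 2 * s - \<delta> + 6 * (s * k)"
      by (simp_all add: algebra_simps)
    then have "F (3 * k + 1) = - (t powi (((b + 2 * s + 6 * s * k)\<^sup>2 - int p) div 2) * t powi (N (b + 2 * s + 6 * s * k) div 3))"
      by (simp only: F_def c eps_periodic eps power2_eq_square mult_minus_left mult_minus_right mult_1)
    also have "\<dots> = - (t powi (14 * k * (3 * k + 1) + 2 * int z * (3 * k + 1) + int \<kappa>))"
      by (subst power_int_mult_divs[OF t(1) N1 r1]) (rule refl)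
    finally show "F (3 * k + 1) = - (t powi (14 * k * (3 * k + 1) + 2 * int z * (3 * k + 1) + int \<kappa>))" .
    have "b + 2 * s * (3 * k + 2) - \<delta> = b + 4 * s - \<delta> + 6 * (s * k)"
      by (simp add: algebra_simps)
    then show "F (3 * k + 2) = 0"
      by (simp only: F_def c eps_periodic eps mult_zero_left mult_zero_right)
  qed
  have "(F has_sum t powi int \<kappa> * mod14_product q z) UNIV"
    unfolding F by (rule has_sum_cmult_right[OF quint_has_sum_mod14_product[OF q1 z]])
  from bailey_lemma[OF t q p b s this[unfolded F_def]] show ?thesis
    by simp
qed

section \<open>The six identities, first for nonzero \<open>q\<close>, then for
  \<open>q = 0\<close>\<close>

lemma double_sums_eq_mod14_product:
  fixes q :: complex
  assumes q1: "norm q < 1" and q0: "q \<noteq> 0"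
  shows "((\<lambda>(i, j). q ^ (3*i^2 + 2*i*j + j^2 - i) / (qpoch q q (2*i + 0) * qpoch q q j)) has_sum
            mod14_product q 3 / qpoch_inf q q) UNIV" (is ?th1)
    and "((\<lambda>(i, j). q ^ (3*i^2 + 2*i*j + j^2 + 2*i + j) / (qpoch q q (2*i + 1) * qpoch q q j)) has_sum
            mod14_product q 4 / qpoch_inf q q) UNIV" (is ?th2)
    and "((\<lambda>(i, j). q ^ (3*i^2 + 2*i*j + j^2) / (qpoch q q (2*i + 0) * qpoch q q j)) has_sum
            mod14_product q 2 / qpoch_inf q q) UNIV" (is ?th3)
    and "((\<lambda>(i, j). q ^ (3*i^2 + 2*i*j + j^2 + 3*i + j) / (qpoch q q (2*i + 1) * qpoch q q j)) has_sum
            mod14_product q 5 / qpoch_inf q q) UNIV" (is ?th4)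
    and "((\<lambda>(i, j). q ^ (3*i^2 + 2*i*j + j^2 + i + j) / (qpoch q q (2*i + 0) * qpoch q q j)) has_sum
            mod14_product q 1 / qpoch_inf q q) UNIV" (is ?th5)
    and "((\<lambda>(i, j). q ^ (3*i^2 + 2*i*j + j^2 + 4*i + 2*j) / (qpoch q q (2*i + 1) * qpoch q q j)) has_sum
            mod14_product q 6 / qpoch_inf q q) UNIV" (is ?th6)
proof -
  \<comment> \<open>The half-integral powers of \<open>q\<close> become powers of \<open>t\<close>.
    The identities then come in pairs, one for each parity of \<open>M\<close>: from
    \<open>aA\<close>, from \<open>aB\<close>, and from \<open>aB\<close> with shifted
    weight.\<close>
  obtain t where q: "q = t\<^sup>2"
    by (metis power2_csqrt)
  then have t: "t \<noteq> 0" "norm t < 1"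
    using q0 q1 by (auto simp: norm_power abs_square_less_1)
  have wt0: "parity_weight t 0 (2 * N) = q ^ (N * N)" for N
    by (simp add: parity_weight_def q flip: power_mult)
  have wt1: "parity_weight t 1 (2 * N + 1) = q ^ (N * N + N)" for N
  proof -
    have "(2 * N + 1) * (2 * N + 1) - 1 = 2 * (2 * (N * N + N))" by (simp add: algebra_simps)
    then have "((2 * N + 1) * (2 * N + 1) - 1) div 2 = 2 * (N * N + N)" by simp
    moreover have "even (2 * N + 1 + 1)" by simp
    ultimately show ?thesis by (simp only: parity_weight_def q power_mult if_True)
  qed
  have aA0: "aA t (2 * i) = q ^ (2 * i * i - i)" for i
  proof -
    have "2 * i * (2 * i - 1) = 2 * (2 * i * i - i)" by (simp add: diff_mult_distrib2 algebra_simps)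
    then show ?thesis by (simp only: aA_def q power_mult)
  qed
  have aA1: "aA t (2 * i + 1) = q ^ (2 * i * i + i)" for i
  proof -
    have "(2 * i + 1) * (2 * i + 1 - 1) = 2 * (2 * i * i + i)" by (simp add: algebra_simps)
    then show ?thesis by (simp only: aA_def q power_mult)
  qed
  have aB0: "aB t (2 * i) = q ^ (2 * i * i)" for i
    by (simp add: aB_def q mult_ac flip: power_mult)
  have aB1: "aB t (2 * i + 1) = t * q ^ (2 * i * i + 2 * i)" for i
  proof -
    have "(2 * i + 1) * (2 * i + 1) = Suc (2 * (2 * i * i + 2 * i))" by (simp add: algebra_simps)
    then show ?thesis by (simp only: aB_def q power_mult power_Suc)
  qed
  have sq: "i \<le> i\<^sup>2" for i :: nat
    by (cases i) (simp_all add: power2_eq_square)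
  have par: "parity_weight t p M = 0" if "odd (M + p)" for p M
    using that by (simp add: parity_weight_def)
  have par': "parity_weight t p (Suc M) = 0" if "odd (M + p')" "p + p' = 1" for p p' M
  proof -
    have "odd (Suc M + p)" using that by presburger
    then show ?thesis by (simp only: parity_weight_def if_False)
  qed
  show ?th1
  proof (rule has_sum_double_eqI[OF q1, where K = "t ^ 0" and x = "parity_weight t 0" and a = "aA t"])
    show "((\<lambda>M. parity_weight t 0 M * two_one_sum q (aA t) M) has_sum t ^ 0 * (mod14_product q 3 / qpoch_inf q q)) UNIV"
      unfolding two_one_sum_eq_bailey_sum[OF t q]
      \<comment> \<open>The sign pattern 1, -1, 0 is met from \<open>r = 0\<close> downwards for
        even \<open>r\<close>, and in the next identity from \<open>r = 1\<close> upwards for odd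
        \<open>r\<close>.\<close>
      by (rule bailey_mod14[OF t q, where b = 0 and s = "- 1" and \<delta> = 0 and N = "\<lambda>r. 2 * r * (r - 1)"
            and ?m0.0 = "\<lambda>k. 4 * k * (6 * k + 1)" and ?m1.0 = "\<lambda>k. (12 * k + 4) * (2 * k + 1)"])
         (simp_all add: cA_def eps_def algebra_simps power2_eq_square)
    show "i + j \<le> 3*i^2 + 2*i*j + j^2 - i" for i j :: nat
      using sq[of i] sq[of j] by linarith
    show "parity_weight t 0 (2 * i + 0 + 2 * j) * aA t (2 * i + 0) = t ^ 0 * q ^ (3*i^2 + 2*i*j + j^2 - i)" for i j
    proof -
      have "i \<le> 2 * i * i"
        by (cases i) auto
      moreover have "(i + j) * (i + j) + 2 * i * i = 3*i^2 + 2*i*j + j^2"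
        by (simp add: power2_eq_square algebra_simps)
      ultimately have "(i + j) * (i + j) + (2 * i * i - i) = 3*i^2 + 2*i*j + j^2 - i"
        by (metis Nat.add_diff_assoc)
      then show ?thesis
        using wt0[of "i + j"] aA0[of i] by (simp flip: power_add)
    qed
  qed (use par in simp_all)
  show ?th2
  proof (rule has_sum_double_eqI[OF q1, where K = "t ^ 0" and x = "parity_weight t 1" and a = "aA t"])
    show "((\<lambda>M. parity_weight t 1 M * two_one_sum q (aA t) M) has_sum t ^ 0 * (mod14_product q 4 / qpoch_inf q q)) UNIV"
      unfolding two_one_sum_eq_bailey_sum[OF t q]
      by (rule bailey_mod14[OF t q, where b = 1 and s = 1 and \<delta> = 0 and N = "\<lambda>r. 2 * r * (r - 1)"
            and ?m0.0 = "\<lambda>k. 4 * k * (6 * k + 1)" and ?m1.0 = "\<lambda>k. 2 * (2 * k + 1) * (6 * k + 2)"])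
         (simp_all add: cA_def eps_def algebra_simps power2_eq_square)
    show "parity_weight t 1 (2 * i + 1 + 2 * j) * aA t (2 * i + 1) = t ^ 0 * q ^ (3*i^2 + 2*i*j + j^2 + 2*i + j)" for i j
    proof -
      have "(i + j) * (i + j) + (i + j) + (2 * i * i + i) = 3*i^2 + 2*i*j + j^2 + 2*i + j"
        by (simp add: power2_eq_square algebra_simps)
      moreover have "2 * i + 1 + 2 * j = 2 * (i + j) + 1" by simp
      ultimately show ?thesis
        by (simp only: wt1 aA1 flip: power_add) simp
    qed
  qed (use par in simp_all)
  show ?th3
  proof (rule has_sum_double_eqI[OF q1, where K = "t ^ 0" and x = "parity_weight t 0" and a = "aB t"])
    show "((\<lambda>M. parity_weight t 0 M * two_one_sum q (aB t) M) has_sum t ^ 0 * (mod14_product q 2 / qpoch_inf q q)) UNIV"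
      unfolding two_one_sum_eq_bailey_sum[OF t q]
      by (rule bailey_mod14[OF t q, where b = 0 and s = "- 1" and \<delta> = 0 and N = "\<lambda>r. r * (2 * r + 1)"
            and ?m0.0 = "\<lambda>k. 2 * k * (12 * k - 1)" and ?m1.0 = "\<lambda>k. (6 * k + 2) * (4 * k + 1)"])
         (simp_all add: cB_def eps_def algebra_simps power2_eq_square)
    show "i + j \<le> 3*i^2 + 2*i*j + j^2" for i j :: nat
      using sq[of i] sq[of j] by linarith
    show "parity_weight t 0 (2 * i + 0 + 2 * j) * aB t (2 * i + 0) = t ^ 0 * q ^ (3*i^2 + 2*i*j + j^2)" for i j
    proof -
      have "(i + j) * (i + j) + 2 * i * i = 3*i^2 + 2*i*j + j^2"
        by (simp add: power2_eq_square algebra_simps)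
      then show ?thesis
        using wt0[of "i + j"] aB0[of i] by (simp flip: power_add)
    qed
  qed (use par in simp_all)
  show ?th4
  proof (rule has_sum_double_eqI[OF q1, where K = "t ^ 1" and x = "parity_weight t 1" and a = "aB t"])
    show "((\<lambda>M. parity_weight t 1 M * two_one_sum q (aB t) M) has_sum t ^ 1 * (mod14_product q 5 / qpoch_inf q q)) UNIV"
      unfolding two_one_sum_eq_bailey_sum[OF t q]
      by (rule bailey_mod14[OF t q, where b = 1 and s = 1 and \<delta> = 0 and N = "\<lambda>r. r * (2 * r + 1)"
            and ?m0.0 = "\<lambda>k. (6 * k + 1) * (4 * k + 1)" and ?m1.0 = "\<lambda>k. (2 * k + 1) * (12 * k + 7)"])
         (simp_all add: cB_def eps_def algebra_simps power2_eq_square)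
    show "parity_weight t 1 (2 * i + 1 + 2 * j) * aB t (2 * i + 1) = t ^ 1 * q ^ (3*i^2 + 2*i*j + j^2 + 3*i + j)" for i j
    proof -
      have "(i + j) * (i + j) + (i + j) + (2 * i * i + 2 * i) = 3*i^2 + 2*i*j + j^2 + 3*i + j"
        by (simp add: power2_eq_square algebra_simps)
      moreover have "2 * i + 1 + 2 * j = 2 * (i + j) + 1" by simp
      ultimately show ?thesis
        by (simp only: wt1 aB1 mult.left_commute[of _ t] power_one_right flip: power_add)
    qed
  qed (use par t in simp_all)
  show ?th5
  \<comment> \<open>The extra \<open>M/2\<close> completes the square:
    \<open>M^2/4 + M/2 = ((M + 1)^2 - 1)/4\<close>. Hence the weight is taken at
    \<open>Suc M\<close>, of opposite parity.\<close>
  proof (rule has_sum_double_eqI[OF q1, where K = "t ^ 0" and x = "\<lambda>M. parity_weight t 1 (Suc M)" and a = "aB t"])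
    show "((\<lambda>M. parity_weight t 1 (Suc M) * two_one_sum q (aB t) M) has_sum t ^ 0 * (mod14_product q 1 / qpoch_inf q q)) UNIV"
      unfolding two_one_sum_eq_bailey_sum[OF t q]
      by (rule bailey_lemma_shifted_B[OF t q],
          rule bailey_mod14[OF t q, where b = 1 and s = "- 1" and \<delta> = 1 and N = "\<lambda>r. (r - 1) * (2 * (r - 1) + 1)"
            and ?m0.0 = "\<lambda>k. 2 * k * (12 * k - 1)" and ?m1.0 = "\<lambda>k. (6 * k + 2) * (4 * k + 1)"])
         (simp_all add: cB_def eps_def algebra_simps power2_eq_square)
    show "parity_weight t 1 (Suc (2 * i + 0 + 2 * j)) * aB t (2 * i + 0) = t ^ 0 * q ^ (3*i^2 + 2*i*j + j^2 + i + j)" for i j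
    proof -
      have "(i + j) * (i + j) + (i + j) + 2 * i * i = 3*i^2 + 2*i*j + j^2 + i + j"
        by (simp add: power2_eq_square algebra_simps)
      moreover have "Suc (2 * i + 0 + 2 * j) = 2 * (i + j) + 1" by simp
      ultimately show ?thesis
        by (simp only: wt1 aB0 add_0_right flip: power_add) simp
    qed
  qed (use par'[where p = 1 and p' = 0] in simp_all)
  show ?th6
  \<comment> \<open>One \<open>t\<close> comes from \<open>aB\<close> at odd \<open>m\<close>, and
    \<open>t^2 = q\<close> from \<open>(i + j + 1)^2\<close> exceeding the wanted exponent by
    1.\<close>
  proof (rule has_sum_double_eqI[OF q1, where K = "t ^ 3" and x = "\<lambda>M. parity_weight t 0 (Suc M)" and a = "aB t"])
    show "((\<lambda>M. parity_weight t 0 (Suc M) * two_one_sum q (aB t) M) has_sum t ^ 3 * (mod14_product q 6 / qpoch_inf q q)) UNIV"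
      unfolding two_one_sum_eq_bailey_sum[OF t q]
      by (rule bailey_lemma_shifted_B[OF t q],
          rule bailey_mod14[OF t q, where b = 2 and s = 1 and \<delta> = 1 and N = "\<lambda>r. (r - 1) * (2 * (r - 1) + 1)"
            and ?m0.0 = "\<lambda>k. (6 * k + 1) * (4 * k + 1)" and ?m1.0 = "\<lambda>k. (2 * k + 1) * (12 * k + 7)"])
         (simp_all add: cB_def eps_def algebra_simps power2_eq_square)
    show "parity_weight t 0 (Suc (2 * i + 1 + 2 * j)) * aB t (2 * i + 1) = t ^ 3 * q ^ (3*i^2 + 2*i*j + j^2 + 4*i + 2*j)" for i j
    proof -
      have "(i + j + 1) * (i + j + 1) + (2 * i * i + 2 * i) = 3*i^2 + 2*i*j + j^2 + 4*i + 2*j + 1"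
        by (simp add: power2_eq_square algebra_simps)
      moreover have "Suc (2 * i + 1 + 2 * j) = 2 * (i + j + 1)" by simp
      ultimately have "parity_weight t 0 (Suc (2 * i + 1 + 2 * j)) * aB t (2 * i + 1)
          = t * q ^ (3*i^2 + 2*i*j + j^2 + 4*i + 2*j + 1)"
        by (simp only: wt0 aB1 mult.left_commute[of _ t] flip: power_add)
      also have "t * q ^ (n + 1) = t ^ 3 * q ^ n" for n
        by (simp add: q power2_eq_square power3_eq_cube)
      finally show ?thesis .
    qed
  qed (use par'[where p = 0 and p' = 1] t in simp_all)
qed

text \<open>Negative powers of \<open>t\<close> exclude \<open>q = 0\<close> above. There
  \<open>0^0 = 1\<close> leaves only the term at \<open>(0, 0)\<close>, and \<open>0 < z < 7\<close>
  keeps every exponent in the product positive, so all factors are 1.\<close>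

lemma has_sum_double_zero:
  assumes e: "\<And>i j. i + j \<le> e i j" "e 0 0 = 0" and z: "0 < z" "z < 7"
  shows "((\<lambda>(i::nat, j::nat). 0 ^ e i j / (qpoch 0 0 (m i) * qpoch 0 0 j)) has_sum
            mod14_product 0 z / qpoch_inf 0 0) UNIV"
proof -
  have [simp]: "qpoch 0 0 n = 1" "qpoch_inf 0 0 = 1" for n
    by (simp_all add: qpoch_def qpoch_inf_def)
  have "mod14_product 0 z = 1"
    using z by (simp add: mod14_product_def qpochs_inf_def zero_power)
  moreover have "e i j = 0 \<longleftrightarrow> i = 0 \<and> j = 0" for i j
    using e(1)[of i j] e(2) by auto
  ultimately show ?thesis
    by (intro has_sum_finite_neutralI[of "{(0, 0)}"]) (auto simp: e(2))
qed

theorem theorem5p6: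
  fixes q :: complex
  assumes "norm q < 1"
  shows
    "(((\<lambda>(i::nat, j::nat). q ^ (3*i^2 + 2*i*j + j^2 - i) / (qpoch q q (2*i) * qpoch q q j)) has_sum
       qpochs_inf [q ^ 3, q ^ 11, q ^ 14] (q ^ 14) * qpochs_inf [q ^ 8, q ^ 20] (q ^ 28) / qpoch_inf q q) UNIV)
    \<and> (((\<lambda>(i::nat, j::nat). q ^ (3*i^2 + 2*i*j + j^2 + 2*i + j) / (qpoch q q (2*i + 1) * qpoch q q j)) has_sum
       qpochs_inf [q ^ 4, q ^ 10, q ^ 14] (q ^ 14) * qpochs_inf [q ^ 6, q ^ 22] (q ^ 28) / qpoch_inf q q) UNIV)
    \<and> (((\<lambda>(i::nat, j::nat). q ^ (3*i^2 + 2*i*j + j^2) / (qpoch q q (2*i) * qpoch q q j)) has_sum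
       qpochs_inf [q ^ 2, q ^ 12, q ^ 14] (q ^ 14) * qpochs_inf [q ^ 10, q ^ 18] (q ^ 28) / qpoch_inf q q) UNIV)
    \<and> (((\<lambda>(i::nat, j::nat). q ^ (3*i^2 + 2*i*j + j^2 + 3*i + j) / (qpoch q q (2*i + 1) * qpoch q q j)) has_sum
       qpochs_inf [q ^ 5, q ^ 9, q ^ 14] (q ^ 14) * qpochs_inf [q ^ 4, q ^ 24] (q ^ 28) / qpoch_inf q q) UNIV)
    \<and> (((\<lambda>(i::nat, j::nat). q ^ (3*i^2 + 2*i*j + j^2 + i + j) / (qpoch q q (2*i) * qpoch q q j)) has_sum
       qpochs_inf [q, q ^ 13, q ^ 14] (q ^ 14) * qpochs_inf [q ^ 12, q ^ 16] (q ^ 28) / qpoch_inf q q) UNIV)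
    \<and> (((\<lambda>(i::nat, j::nat). q ^ (3*i^2 + 2*i*j + j^2 + 4*i + 2*j) / (qpoch q q (2*i + 1) * qpoch q q j)) has_sum
       qpochs_inf [q ^ 6, q ^ 8, q ^ 14] (q ^ 14) * qpochs_inf [q ^ 2, q ^ 26] (q ^ 28) / qpoch_inf q q) UNIV)"
proof -
  have "((\<lambda>(i, j). q ^ (3*i^2 + 2*i*j + j^2 - i) / (qpoch q q (2*i + 0) * qpoch q q j)) has_sum
            mod14_product q 3 / qpoch_inf q q) UNIV \<and>
        ((\<lambda>(i, j). q ^ (3*i^2 + 2*i*j + j^2 + 2*i + j) / (qpoch q q (2*i + 1) * qpoch q q j)) has_sum
            mod14_product q 4 / qpoch_inf q q) UNIV \<and>
        ((\<lambda>(i, j). q ^ (3*i^2 + 2*i*j + j^2) / (qpoch q q (2*i + 0) * qpoch q q j)) has_sum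
            mod14_product q 2 / qpoch_inf q q) UNIV \<and>
        ((\<lambda>(i, j). q ^ (3*i^2 + 2*i*j + j^2 + 3*i + j) / (qpoch q q (2*i + 1) * qpoch q q j)) has_sum
            mod14_product q 5 / qpoch_inf q q) UNIV \<and>
        ((\<lambda>(i, j). q ^ (3*i^2 + 2*i*j + j^2 + i + j) / (qpoch q q (2*i + 0) * qpoch q q j)) has_sum
            mod14_product q 1 / qpoch_inf q q) UNIV \<and>
        ((\<lambda>(i, j). q ^ (3*i^2 + 2*i*j + j^2 + 4*i + 2*j) / (qpoch q q (2*i + 1) * qpoch q q j)) has_sum
            mod14_product q 6 / qpoch_inf q q) UNIV"
  proof (cases "q = 0")
    case True
    have sq: "i \<le> i\<^sup>2" for i :: nat
      by (cases i) (simp_all add: power2_eq_square)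
    have "i + j \<le> 3*i^2 + 2*i*j + j^2 - i" "i + j \<le> 3*i^2 + 2*i*j + j^2" for i j :: nat
      using sq[of i] sq[of j] by linarith+
    then show ?thesis
      unfolding True by (intro conjI has_sum_double_zero) simp_all
  next
    case False
    show ?thesis
      by (intro conjI double_sums_eq_mod14_product assms False)
  qed
  then show ?thesis
    by (simp add: mod14_product_def)
qed

end
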